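(* Assume that $f_i$, $0\le i\le m$, are differentiable on $X$, and that for some $M_1>0$, $M_2>0$ one has for $i=0,1,\dots,m$ and all $x\in X$ $$\mathbf{E}\Big[e^{(F_i(x,\xi)-f_i(x))^2/M_1^2}\Big]\le e,\qquad \mathbf{E}\Big[e^{L^2(x,\xi)/M_2^2}\Big]\le e .$$ Assume also that the problem $$\mathrm{Opt}=\min_{x\in X}\{f_0(x):\ f_i(x)\le0,\ 1\le i\le m\}$$ is feasible, and that for a positive integer $N$, $s>1$ and $\lambda,\mu\in[0,2\sqrt{\tau_*N}]$, the reals $\epsilon$ and $\beta$ satisfy $$\epsilon>2N^{-1/2}\left[\mu M_1+M_2R\left[\tfrac{\Omega}{2}(1+s^2)+\lambda\right]\right],\qquad \beta=e^{-N(s^2-1)}+e^{-\frac{\lambda^2}{4\tau_*}}+(m+2)e^{-\frac{\mu^2}{4\tau_*}} .$$ Then the random quantity $$\mathrm{Opt}_N(\xi^N)=\min_{x\in X}\Big\{f_{0,N}(x,\xi^N)-\mu M_1N^{-1/2}:\ f_{i,N}(x,\xi^N)-\mu M_1N^{-1/2}\le0,\ 1\le i\le m\Big\}$$ $\epsilon$-underestimates $\mathrm{Opt}$ with probability at least $1-\beta$.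
   Context: $E$ is a Euclidean space, $\|\cdot\|$ a norm on $E$ (not necessarily the Euclidean one), $B_{\|\cdot\|}$ its unit ball, and $\|y\|_*=\max_{\|x\|\le1}\langle x,y\rangle$ the conjugate norm. $\omega$ is a function continuously differentiable on $B_{\|\cdot\|}$, strongly convex with parameter one with respect to $\|\cdot\|$, i.e. $\langle\nabla\omega(x)-\nabla\omega(y),x-y\rangle\ge\|x-y\|^2$ for all $x,y\in B_{\|\cdot\|}$, and with $\omega(0)=0$, $\omega'(0)=0$. Set $\Omega=\max_{\|x\|\le1}\sqrt{2\omega(x)}$. $X\subset E$ is a nonempty convex compact set and $R$ is the smallest radius of a $\|\cdot\|$-ball containing $X$. $P$ is a Borel probability distribution on $\mathbf{R}^k$ with support $\Xi$, $\xi\sim P$. $F_i:E\times\Xi\to\mathbf{R}$, $0\le i\le m$, are Borel functions convex in $x$ and $P$-summable in $\xi$ for every $x$; $f_i(x)=\int_\Xi F_i(x,\xi)P(d\xi)$ (convex functions on $E$), and $$L(x,\xi)=\max_{0\le i\le m}\{\|g-h\|_*:\ g\in\partial_xF_i(x,\xi),\ h\in\partial f_i(x)\}.$$ $f_{i,N}(x,\xi^N)=\frac1N\sum_{t=1}^NF_i(x,\xi_t)$, where $\xi^N=(\xi_1,\dots,\xi_N)$ and $\xi_1,\xi_2,\dots$ are drawn independently from $P$. Let $\Phi(r)=\min_{x\in X}\max[f_0(x)-r,f_1(x),\dots,f_m(x)]$, $r\in\mathbf{R}$. Given $\epsilon>0$, a real $\rho$ is said to $\epsilon$-underestimate $\mathrm{Opt}$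 if $\rho\le\mathrm{Opt}$ and $\Phi(\rho)\le\epsilon$. $\tau_*=0.557409\ldots$ is the smallest positive real such that $e^t\le t+e^{\tau_*t^2}$ for all $t\in\mathbf{R}$. *)

theory Defs
  imports "HOL-Probability.Probability"
begin

text \<open>
  Maxima and minima over infinite sets are written with \<^const>\<open>Sup\<close> and \<^const>\<open>Inf\<close> when the
  sets are nonempty and the extremum is attained by compactness. This is the case for every real
  \<^const>\<open>Sup\<close> and \<^const>\<open>Inf\<close> below, in the setting where the definition is used.
\<close>

definition is_norm :: "('a::real_vector \<Rightarrow> real) \<Rightarrow> bool" where
  "is_norm nrm \<longleftrightarrow>
     (\<forall>x. 0 \<le> nrm x) \<and> (\<forall>x. nrm x = 0 \<longleftrightarrow> x = 0) \<and>
     (\<forall>c x. nrm (c *\<^sub>R x) = \<bar>c\<bar> * nrm x) \<and>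
     (\<forall>x y. nrm (x + y) \<le> nrm x + nrm y)"

definition unit_ball :: "('a::real_vector \<Rightarrow> real) \<Rightarrow> 'a set" where
  "unit_ball nrm = {x. nrm x \<le> 1}"

definition dual_norm :: "('a::euclidean_space \<Rightarrow> real) \<Rightarrow> 'a \<Rightarrow> real" where
  "dual_norm nrm y = (SUP x\<in>unit_ball nrm. x \<bullet> y)"

text \<open>
  \<^term>\<open>g\<close> is the continuous gradient of \<^term>\<open>w\<close> on the unit ball. At boundary points the derivative
  is taken within the ball; it is unique since the ball is convex with nonempty interior.
\<close>

definition C1_on_ball_with_gradient ::
    "('a::euclidean_space \<Rightarrow> real) \<Rightarrow> ('a \<Rightarrow> real) \<Rightarrow> ('a \<Rightarrow> 'a) \<Rightarrow> bool" where
  "C1_on_ball_with_gradient nrm w g \<longleftrightarrow>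
     continuous_on (unit_ball nrm) g \<and>
     (\<forall>x\<in>unit_ball nrm. (w has_derivative (\<lambda>h. g x \<bullet> h)) (at x within unit_ball nrm))"

definition covering_radius :: "('a::euclidean_space \<Rightarrow> real) \<Rightarrow> 'a set \<Rightarrow> real" where
  "covering_radius nrm X = Inf {r. 0 \<le> r \<and> (\<exists>c. X \<subseteq> {x. nrm (x - c) \<le> r})}"

text \<open>The smallest closed set of full measure, in its pointwise form.\<close>

definition measure_support :: "'b::topological_space measure \<Rightarrow> 'b set" where
  "measure_support P = {z. \<forall>U. open U \<and> z \<in> U \<longrightarrow> 0 < emeasure P U}"

definition subdifferential :: "('a::real_inner \<Rightarrow> real) \<Rightarrow> 'a \<Rightarrow> 'a set" where
  "subdifferential f x = {g. \<forall>y. f x + g \<bullet> (y - x) \<le> f y}"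

definition subgrad_deviation ::
    "('a::euclidean_space \<Rightarrow> real) \<Rightarrow> nat \<Rightarrow> (nat \<Rightarrow> 'a \<Rightarrow> 'b \<Rightarrow> real) \<Rightarrow> (nat \<Rightarrow> 'a \<Rightarrow> real) \<Rightarrow>
     'a \<Rightarrow> 'b \<Rightarrow> real" where
  "subgrad_deviation nrm m F f x z =
     Sup {dual_norm nrm (g - h) | i g h.
            i \<le> m \<and> g \<in> subdifferential (\<lambda>y. F i y z) x \<and> h \<in> subdifferential (f i) x}"

definition sample_average ::
    "(nat \<Rightarrow> 'a \<Rightarrow> 'b \<Rightarrow> real) \<Rightarrow> nat \<Rightarrow> (nat \<Rightarrow> 'b) \<Rightarrow> nat \<Rightarrow> 'a \<Rightarrow> real" where
  "sample_average F N z i x = (1 / real N) * (\<Sum>t=1..N. F i x (z t))"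

text \<open>
  The optimal value is extended-real, so that it is \<^term>\<open>\<infinity>::ereal\<close> for an infeasible problem
  (a sampled problem may be infeasible).
\<close>

definition opt_value :: "'a set \<Rightarrow> nat \<Rightarrow> (nat \<Rightarrow> 'a \<Rightarrow> real) \<Rightarrow> ereal" where
  "opt_value X m f = (INF x\<in>{x\<in>X. \<forall>i\<in>{1..m}. f i x \<le> 0}. ereal (f 0 x))"

definition Phi :: "'a set \<Rightarrow> nat \<Rightarrow> (nat \<Rightarrow> 'a \<Rightarrow> real) \<Rightarrow> real \<Rightarrow> real" where
  "Phi X m f r = (INF x\<in>X. Max (insert (f 0 x - r) ((\<lambda>i. f i x) ` {1..m})))"

definition underestimates ::
    "real \<Rightarrow> 'a set \<Rightarrow> nat \<Rightarrow> (nat \<Rightarrow> 'a \<Rightarrow> real) \<Rightarrow> real \<Rightarrow> bool" where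
  "underestimates eps X m f \<rho> \<longleftrightarrow> ereal \<rho> \<le> opt_value X m f \<and> Phi X m f \<rho> \<le> eps"

definition tau_star :: real where
  "tau_star = (LEAST \<tau>. 0 < \<tau> \<and> (\<forall>t::real. exp t \<le> t + exp (\<tau> * t\<^sup>2)))"

end

theory Submission
  imports Defs
begin

text \<open>
  Only finitely many unfavourable events have to be excluded, because all the deviations that matter
  are deviations at two fixed points of \<^term>\<open>X\<close>.

  The inequality \<^term>\<open>\<rho> \<le> Opt\<close>, for \<^term>\<open>\<rho>\<close> the sampled optimal value, fails only if at
  an optimal point of the true problem one of the \<^term>\<open>m + 1\<close> sampled functions exceeds its
  mean by more than the slack subtracted from it.

  For \<^term>\<open>Phi X m f \<rho> \<le> \<epsilon>\<close>, let \<^term>\<open>r\<close> be the smallest number at which the residual is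
  at most \<^term>\<open>\<epsilon>\<close>. Then the functions \<^term>\<open>f 0 - r\<close>, \<^term>\<open>f 1\<close>, ..., \<^term>\<open>f m\<close> are
  nowhere on \<^term>\<open>X\<close> all below \<^term>\<open>\<epsilon>\<close>, so a convex combination of them, with fixed weights, is
  at least \<^term>\<open>\<epsilon>\<close> on \<^term>\<open>X\<close> (\<open>convex_multipliers\<close>). Let \<^term>\<open>c\<close> be a minimizer on
  \<^term>\<open>X\<close> of this combination. If \<^term>\<open>\<rho> < r\<close>, the sampled combination is at most the slack
  somewhere on \<^term>\<open>X\<close>. On the other hand it lies above its linearization at \<^term>\<open>c\<close>, and this
  linearization is close to that of the true combination, whose gradient at \<^term>\<open>c\<close> is
  nonnegative in all directions into \<^term>\<open>X\<close>. So it suffices to control the sampled value and the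
  sampled gradient at the single point \<^term>\<open>c\<close>.

  A differentiable average of convex functions forces almost every one of them to have a unique
  subgradient at the point in question, and this subgradient is a measurable function of the sample
  whose mean is the gradient of the average (\<open>AE_unique_subgradient\<close>). Hence the gradient error
  is a normalized sum of independent mean-zero vectors. Its conjugate norm is bounded in
  \<open>tail_dual_norm_sum\<close>. Dual averaging with the strongly convex function \<^term>\<open>\<omega>\<close> bounds the norm
  of a sum of vectors by the sum of their squared norms and of their inner products with
  predictable points of the unit ball (\<open>dual_averaging_regret\<close>), and both sums have exponential
  tails. The constant \<^const>\<open>tau_star\<close> enters through the moment bound \<open>mgf_bound\<close>.
\<close>

section \<open>Norms and their conjugates\<close>

context
  fixes nrm :: "'a::euclidean_space \<Rightarrow> real"
  assumes is_norm: "is_norm nrm"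
begin

lemma nrm_nonneg: "0 \<le> nrm x"
  and nrm_eq_0: "nrm x = 0 \<longleftrightarrow> x = 0"
  and nrm_scaleR: "nrm (c *\<^sub>R x) = \<bar>c\<bar> * nrm x"
  and nrm_triangle: "nrm (x + y) \<le> nrm x + nrm y"
  using is_norm by (auto simp: is_norm_def)

lemma nrm_0: "nrm 0 = 0"
  by (simp add: nrm_eq_0)

lemma nrm_minus: "nrm (- x) = nrm x"
  using nrm_scaleR[of "-1" x] by simp

lemma nrm_diff_swap: "nrm (x - y) = nrm (y - x)"
  using nrm_minus[of "x - y"] by simp

lemma convex_on_nrm: "convex_on UNIV nrm"
proof (rule convex_onI)
  fix t :: real and x y assume t: "0 < t" "t < 1"
  show "nrm ((1 - t) *\<^sub>R x + t *\<^sub>R y) \<le> (1 - t) * nrm x + t * nrm y"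
    using nrm_triangle[of "(1 - t) *\<^sub>R x" "t *\<^sub>R y"] t by (simp add: nrm_scaleR)
qed simp

lemma continuous_on_nrm: "continuous_on UNIV nrm"
  by (rule convex_on_continuous) (use convex_on_nrm in auto)

lemma nrm_bounds_norm: "\<exists>c>0. \<forall>x. c * norm x \<le> nrm x"
proof -
  have "sphere (0::'a) 1 \<noteq> {}" by simp
  then obtain u :: 'a where u: "norm u = 1" "\<And>y. norm y = 1 \<Longrightarrow> nrm u \<le> nrm y"
    using continuous_attains_inf[OF compact_sphere, of 0 1 nrm]
      continuous_on_subset[OF continuous_on_nrm] by (auto simp: sphere_def)
  show ?thesis
  proof (intro exI conjI allI)
    show "0 < nrm u" using u(1) nrm_nonneg[of u] nrm_eq_0[of u] by fastforce
    fix x show "nrm u * norm x \<le> nrm x"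
    proof (cases "x = 0")
      case False
      have "nrm u \<le> nrm (x /\<^sub>R norm x)" using False by (intro u(2)) simp
      then show ?thesis using False by (simp add: nrm_scaleR field_simps)
    qed (simp add: nrm_0)
  qed
qed

lemma mem_unit_ball: "x \<in> unit_ball nrm \<longleftrightarrow> nrm x \<le> 1"
  by (simp add: unit_ball_def)

lemma convex_unit_ball: "convex (unit_ball nrm)"
proof (rule convexI)
  fix x y and u v :: real
  assume "x \<in> unit_ball nrm" "y \<in> unit_ball nrm" and uv: "0 \<le> u" "0 \<le> v" "u + v = 1"
  then have "u * nrm x + v * nrm y \<le> 1"
    by (intro convex_bound_le) (auto simp: mem_unit_ball)
  then show "u *\<^sub>R x + v *\<^sub>R y \<in> unit_ball nrm"
    using nrm_triangle[of "u *\<^sub>R x" "v *\<^sub>R y"] uv by (simp add: mem_unit_ball nrm_scaleR)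
qed

lemma compact_unit_ball: "compact (unit_ball nrm)"
proof -
  obtain c where c: "c > 0" "\<And>x. c * norm x \<le> nrm x" using nrm_bounds_norm by blast
  have "norm x \<le> 1 / c" if "nrm x \<le> 1" for x
    using c(2)[of x] that c(1) by (simp add: field_simps)
  then have "bounded (unit_ball nrm)" by (auto simp: bounded_iff unit_ball_def)
  moreover have "closed (unit_ball nrm)"
    unfolding unit_ball_def by (intro closed_Collect_le continuous_on_nrm continuous_intros)
  ultimately show ?thesis by (simp add: compact_eq_bounded_closed)
qed

lemma zero_in_unit_ball: "0 \<in> unit_ball nrm"
  by (simp add: mem_unit_ball nrm_0)

lemma dual_norm_bdd: "bdd_above ((\<lambda>x. x \<bullet> y) ` unit_ball nrm)"
  by (intro bounded_imp_bdd_above compact_imp_bounded compact_continuous_image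
      compact_unit_ball continuous_intros)

lemma dual_norm_upper: "nrm x \<le> 1 \<Longrightarrow> x \<bullet> y \<le> dual_norm nrm y"
  unfolding dual_norm_def by (rule cSUP_upper[OF _ dual_norm_bdd]) (simp add: mem_unit_ball)

lemma dual_norm_least: "(\<And>x. nrm x \<le> 1 \<Longrightarrow> x \<bullet> y \<le> c) \<Longrightarrow> dual_norm nrm y \<le> c"
  unfolding dual_norm_def using zero_in_unit_ball
  by (intro cSUP_least) (auto simp: mem_unit_ball)

lemma dual_norm_nonneg: "0 \<le> dual_norm nrm y"
  using dual_norm_upper[of 0 y] by (simp add: nrm_0)

lemma inner_le_nrm_dual_norm: "x \<bullet> y \<le> nrm x * dual_norm nrm y"
proof (cases "x = 0")
  case False
  then have pos: "0 < nrm x" using nrm_nonneg[of x] nrm_eq_0[of x] by linarith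
  then have "(x /\<^sub>R nrm x) \<bullet> y \<le> dual_norm nrm y"
    by (intro dual_norm_upper) (simp add: nrm_scaleR)
  then show ?thesis using pos by (simp add: field_simps)
qed (simp add: nrm_0)

lemma abs_inner_le_dual_norm: "nrm x \<le> 1 \<Longrightarrow> \<bar>x \<bullet> y\<bar> \<le> dual_norm nrm y"
  using dual_norm_upper[of x y] dual_norm_upper[of "- x" y] by (auto simp: nrm_minus)

lemma dual_norm_triangle: "dual_norm nrm (y + z) \<le> dual_norm nrm y + dual_norm nrm z"
  by (rule dual_norm_least) (simp add: inner_add_right add_mono dual_norm_upper)

lemma dual_norm_scaleR:
  assumes "0 \<le> c" shows "dual_norm nrm (c *\<^sub>R y) = c * dual_norm nrm y"
proof (rule antisym)
  show "dual_norm nrm (c *\<^sub>R y) \<le> c * dual_norm nrm y"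
    by (rule dual_norm_least) (simp add: mult_left_mono dual_norm_upper assms)
  show "c * dual_norm nrm y \<le> dual_norm nrm (c *\<^sub>R y)"
  proof (cases "c = 0")
    case False
    then have "dual_norm nrm y \<le> dual_norm nrm (c *\<^sub>R y) / c"
      using assms dual_norm_upper[of _ "c *\<^sub>R y"]
      by (intro dual_norm_least) (simp add: field_simps)
    then show ?thesis using False assms by (simp add: field_simps)
  qed (simp add: dual_norm_nonneg)
qed

lemma dual_norm_sum:
  "finite I \<Longrightarrow> dual_norm nrm (\<Sum>i\<in>I. y i) \<le> (\<Sum>i\<in>I. dual_norm nrm (y i))"
proof (induction I rule: finite_induct)
  case empty
  show ?case by (simp add: dual_norm_least)
next
  case (insert i I)
  then show ?case using dual_norm_triangle[of "y i" "\<Sum>i\<in>I. y i"] by simp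
qed

lemma continuous_on_dual_norm: "continuous_on UNIV (dual_norm nrm)"
proof (rule convex_on_continuous)
  show "convex_on UNIV (dual_norm nrm)"
  proof (rule convex_onI)
    fix t :: real and x y assume t: "0 < t" "t < 1"
    show "dual_norm nrm ((1 - t) *\<^sub>R x + t *\<^sub>R y) \<le> (1 - t) * dual_norm nrm x + t * dual_norm nrm y"
      using dual_norm_triangle[of "(1 - t) *\<^sub>R x" "t *\<^sub>R y"] t by (simp add: dual_norm_scaleR)
  qed simp
qed auto

lemma borel_measurable_dual_norm [measurable]: "dual_norm nrm \<in> borel_measurable borel"
  by (rule borel_measurable_continuous_onI[OF continuous_on_dual_norm])

lemma dual_norm_le_norm: "\<exists>C\<ge>0. \<forall>y. dual_norm nrm y \<le> C * norm y"
proof -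
  obtain c where c: "c > 0" "\<And>x. c * norm x \<le> nrm x" using nrm_bounds_norm by blast
  have "dual_norm nrm y \<le> 1 / c * norm y" for y
  proof (rule dual_norm_least)
    fix x assume x: "nrm x \<le> 1"
    have "x \<bullet> y \<le> norm x * norm y" by (rule norm_cauchy_schwarz)
    also have "norm x \<le> 1 / c" using c(2)[of x] x c(1) by (simp add: field_simps)
    finally show "x \<bullet> y \<le> 1 / c * norm y" by (simp add: mult_right_mono)
  qed
  then show ?thesis using c(1) by (intro exI[of _ "1 / c"]) auto
qed

text \<open>
  Every ball that contains \<^term>\<open>X\<close> gives this bound with its own radius, so it survives the
  passage to the infimum.
\<close>

lemma nrm_diff_le_covering_radius:
  assumes "compact X" "x \<in> X" "y \<in> X"
  shows "nrm (x - y) \<le> 2 * covering_radius nrm X"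
proof -
  let ?S = "{r. 0 \<le> r \<and> (\<exists>c. X \<subseteq> {x. nrm (x - c) \<le> r})}"
  have "bdd_above (nrm ` X)"
    using assms(1) by (intro bounded_imp_bdd_above compact_imp_bounded compact_continuous_image
      continuous_on_subset[OF continuous_on_nrm]) auto
  then obtain b where b: "\<And>x. x \<in> X \<Longrightarrow> nrm x \<le> b" by (auto simp: bdd_above_def)
  then have "b \<in> ?S" using order_trans[OF nrm_nonneg b[OF assms(2)]] by (auto intro!: exI[of _ 0])
  moreover have "nrm (x - y) / 2 \<le> r" if "r \<in> ?S" for r
  proof -
    from that obtain c where "X \<subseteq> {x. nrm (x - c) \<le> r}" by blast
    then have "nrm (x - c) \<le> r" "nrm (y - c) \<le> r" using assms by auto
    then show ?thesis using nrm_triangle[of "x - c" "c - y"] nrm_diff_swap[of c y] by simp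
  qed
  ultimately have "nrm (x - y) / 2 \<le> covering_radius nrm X"
    unfolding covering_radius_def by (intro cInf_greatest) auto
  then show ?thesis by simp
qed

section \<open>Regret of dual averaging\<close>

context
  fixes \<omega> :: "'a \<Rightarrow> real" and grad\<omega> :: "'a \<Rightarrow> 'a"
  assumes C1: "C1_on_ball_with_gradient nrm \<omega> grad\<omega>"
    and strong: "\<And>x y. x \<in> unit_ball nrm \<Longrightarrow> y \<in> unit_ball nrm \<Longrightarrow>
           (grad\<omega> x - grad\<omega> y) \<bullet> (x - y) \<ge> (nrm (x - y))\<^sup>2"
begin

lemma continuous_on_distance_generating: "continuous_on (unit_ball nrm) \<omega>"
  using C1 unfolding C1_on_ball_with_gradient_def
  by (intro has_derivative_continuous_on) auto

text \<open>
  Along the segment from \<^term>\<open>x\<close> to \<^term>\<open>y\<close>, subtracting the linear and the quadratic term from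
  \<^term>\<open>\<omega>\<close> leaves a function whose derivative is nonnegative by the monotonicity of the gradient.
\<close>

lemma strongly_convex_lower_bound:
  assumes x: "x \<in> unit_ball nrm" and y: "y \<in> unit_ball nrm"
  shows "\<omega> x + grad\<omega> x \<bullet> (y - x) + (nrm (y - x))\<^sup>2 / 2 \<le> \<omega> y"
proof -
  define d where "d = y - x"
  define h where "h t = \<omega> (x + t *\<^sub>R d) - t * (grad\<omega> x \<bullet> d) - t\<^sup>2 / 2 * (nrm d)\<^sup>2" for t
  have mem: "x + t *\<^sub>R d \<in> unit_ball nrm" if "t \<in> {0..1}" for t
    using convexD_alt[OF convex_unit_ball x y, of t] that by (simp add: d_def algebra_simps)
  have der: "(h has_derivative (\<lambda>u. u * (grad\<omega> (x + t *\<^sub>R d) \<bullet> d - grad\<omega> x \<bullet> d - t * (nrm d)\<^sup>2)))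
      (at t within {0..1})" if t: "t \<in> {0..1}" for t
  proof -
    have "((\<lambda>t. \<omega> (x + t *\<^sub>R d)) has_derivative (\<lambda>u. grad\<omega> (x + t *\<^sub>R d) \<bullet> (u *\<^sub>R d)))
        (at t within {0..1})"
    proof (rule has_derivative_in_compose2[where t = "unit_ball nrm" and g = \<omega>
          and g' = "\<lambda>y h. grad\<omega> y \<bullet> h" and f = "\<lambda>t. x + t *\<^sub>R d", OF _ _ t])
      show "(\<omega> has_derivative (\<lambda>h. grad\<omega> y \<bullet> h)) (at y within unit_ball nrm)"
        if "y \<in> unit_ball nrm" for y
        using C1 that by (simp add: C1_on_ball_with_gradient_def)
      show "(\<lambda>t. x + t *\<^sub>R d) ` {0..1} \<subseteq> unit_ball nrm" using mem by auto
      show "((\<lambda>t. x + t *\<^sub>R d) has_derivative (\<lambda>u. u *\<^sub>R d)) (at t within {0..1})"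
        by (auto intro!: derivative_eq_intros)
    qed
    then show ?thesis unfolding h_def
      by (auto intro!: derivative_eq_intros simp: algebra_simps power2_eq_square)
  qed
  have "\<exists>t\<in>{0<..<1}. h 1 - h 0 = (1 - 0) * (grad\<omega> (x + t *\<^sub>R d) \<bullet> d - grad\<omega> x \<bullet> d - t * (nrm d)\<^sup>2)"
    by (rule mvt_simple) (use der in auto)
  then obtain t where t: "0 < t" "t < 1"
    and eq: "h 1 - h 0 = grad\<omega> (x + t *\<^sub>R d) \<bullet> d - grad\<omega> x \<bullet> d - t * (nrm d)\<^sup>2" by auto
  have "t * (t * (nrm d)\<^sup>2) \<le> t * (grad\<omega> (x + t *\<^sub>R d) \<bullet> d - grad\<omega> x \<bullet> d)"
    using strong[OF mem[of t] x] t
    by (simp add: nrm_scaleR power_mult_distrib inner_diff_left power2_eq_square algebra_simps)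
  then have "h 0 \<le> h 1" using eq t by (simp add: mult_le_cancel_left_pos)
  then show ?thesis by (simp add: h_def d_def)
qed

text \<open>
  The maximizer of \<open>s \<bullet> y - \<omega> y\<close> over the ball is the gradient at \<^term>\<open>s\<close> of the
  conjugate of \<^term>\<open>\<omega>\<close>. The quadratic gap adds the first-order condition at the maximizer to the strong
  convexity of \<^term>\<open>\<omega>\<close>.
\<close>

lemma mirror_map_exists:
  "\<exists>v. \<forall>s. v s \<in> unit_ball nrm \<and>
     (\<forall>y\<in>unit_ball nrm. s \<bullet> y - \<omega> y \<le> s \<bullet> v s - \<omega> (v s) - (nrm (y - v s))\<^sup>2 / 2)"
proof (intro choice allI)
  fix s
  let ?B = "unit_ball nrm"
  have "continuous_on ?B (\<lambda>y. s \<bullet> y - \<omega> y)"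
    by (intro continuous_intros continuous_on_distance_generating)
  then obtain v where v: "v \<in> ?B" and max: "\<And>y. y \<in> ?B \<Longrightarrow> s \<bullet> y - \<omega> y \<le> s \<bullet> v - \<omega> v"
    using continuous_attains_sup[OF compact_unit_ball] zero_in_unit_ball by blast
  \<comment> \<open>Compare \<^term>\<open>v\<close> with points of the segment towards \<^term>\<open>y\<close> that approach \<^term>\<open>v\<close>; there
    the gradient inequality gives the condition with the gradient at those points.\<close>
  have first_order: "s \<bullet> (y - v) \<le> grad\<omega> v \<bullet> (y - v)" if y: "y \<in> ?B" for y
  proof -
    define w where "w n = v + (1 / real (Suc n)) *\<^sub>R (y - v)" for n
    have w: "w n \<in> ?B" for n
      using convexD_alt[OF convex_unit_ball v y, of "1 / real (Suc n)"]
      by (simp add: w_def algebra_simps)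
    have "w \<longlonglongrightarrow> v + 0 *\<^sub>R (y - v)"
      unfolding w_def by (intro tendsto_intros LIMSEQ_Suc lim_1_over_n)
    then have lim: "w \<longlonglongrightarrow> v" by simp
    have "(\<lambda>n. grad\<omega> (w n)) \<longlonglongrightarrow> grad\<omega> v"
      using continuous_on_tendsto_compose[of ?B grad\<omega> w v] C1 lim v w
      by (simp add: C1_on_ball_with_gradient_def)
    then have "(\<lambda>n. grad\<omega> (w n) \<bullet> (y - v)) \<longlonglongrightarrow> grad\<omega> v \<bullet> (y - v)"
      by (intro tendsto_intros)
    moreover have "s \<bullet> (y - v) \<le> grad\<omega> (w n) \<bullet> (y - v)" for n
    proof -
      have "\<omega> (w n) + grad\<omega> (w n) \<bullet> (v - w n) \<le> \<omega> v"
        using strongly_convex_lower_bound[OF w[of n] v] zero_le_power2[of "nrm (v - w n)"]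
        by linarith
      moreover have "v - w n = - (1 / real (Suc n)) *\<^sub>R (y - v)" by (simp add: w_def)
      moreover have "s \<bullet> w n = s \<bullet> v + (1 / real (Suc n)) * (s \<bullet> (y - v))"
        by (simp add: w_def inner_add_right)
      ultimately have "(1 / real (Suc n)) * (s \<bullet> (y - v)) \<le> (1 / real (Suc n)) * (grad\<omega> (w n) \<bullet> (y - v))"
        using max[OF w[of n]] by simp
      then show ?thesis by (simp add: divide_le_cancel)
    qed
    ultimately show ?thesis by (intro LIMSEQ_le_const) auto
  qed
  have "s \<bullet> y - \<omega> y \<le> s \<bullet> v - \<omega> v - (nrm (y - v))\<^sup>2 / 2" if "y \<in> ?B" for y
    using strongly_convex_lower_bound[OF v that] first_order[OF that]
    by (simp add: inner_diff_right)
  with v show "\<exists>v. v \<in> ?B \<and> (\<forall>y\<in>?B. s \<bullet> y - \<omega> y \<le> s \<bullet> v - \<omega> v - (nrm (y - v))\<^sup>2 / 2)"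
    by blast
qed

text \<open>
  By the quadratic gap at the maximizer \<^term>\<open>v s\<close>, the conjugate of \<^term>\<open>\<omega>\<close> grows, when a vector
  \<open>\<delta>\<close> is added to its argument \<^term>\<open>s\<close>, by at most \<open>v s \<bullet> \<delta>\<close> plus half the
  squared conjugate norm of \<open>\<delta>\<close>. Summing these increments bounds the conjugate at the full
  sum, and the conjugate differs from the conjugate norm by at most the maximum of
  \<^term>\<open>\<omega>\<close>, which is half of \<open>\<Omega>\<^sup>2\<close>. The points \<^term>\<open>v\<close> depend only on the vectors
  added before; continuity of \<^term>\<open>v\<close> is what makes them measurable for random vectors.
\<close>

lemma dual_averaging_regret:
  assumes \<omega>0: "\<omega> 0 = 0" and grad0: "grad\<omega> 0 = 0"
    and \<Omega>: "\<Omega> = (SUP x\<in>unit_ball nrm. sqrt (2 * \<omega> x))"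
  shows "0 < \<Omega>"
    and "\<exists>v. continuous_on UNIV v \<and> (\<forall>s. nrm (v s) \<le> 1) \<and>
      (\<forall>(D :: nat \<Rightarrow> 'a) n. dual_norm nrm (\<Sum>t=1..n. D t) \<le>
         \<Omega>\<^sup>2 / 2 + (\<Sum>t=1..n. v (\<Sum>u=1..<t. D u) \<bullet> D t) + (\<Sum>t=1..n. (dual_norm nrm (D t))\<^sup>2) / 2)"
proof -
  let ?B = "unit_ball nrm"
  have lower: "(nrm y)\<^sup>2 / 2 \<le> \<omega> y" if "y \<in> ?B" for y
    using strongly_convex_lower_bound[OF zero_in_unit_ball that] by (simp add: \<omega>0 grad0)
  have "bdd_above ((\<lambda>x. sqrt (2 * \<omega> x)) ` ?B)"
    by (intro bounded_imp_bdd_above compact_imp_bounded compact_continuous_image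
        compact_unit_ball continuous_intros continuous_on_distance_generating)
  then have up: "sqrt (2 * \<omega> x) \<le> \<Omega>" if "x \<in> ?B" for x
    unfolding \<Omega> using that by (intro cSUP_upper)
  have upper: "\<omega> x \<le> \<Omega>\<^sup>2 / 2" if "x \<in> ?B" for x
  proof -
    have "0 \<le> \<omega> x" using lower[OF that] zero_le_power2[of "nrm x"] by linarith
    then show ?thesis using power_mono[OF up[OF that], of 2] by simp
  qed
  obtain b :: 'a where b: "b \<in> Basis" using nonempty_Basis by blast
  define e where "e = b /\<^sub>R nrm b"
  have "nrm e = 1" using nonzero_Basis[OF b] nrm_nonneg[of b] nrm_eq_0[of b]
    by (simp add: e_def nrm_scaleR)
  then have "e \<in> ?B" "1 / 2 \<le> \<omega> e" using lower[of e] by (auto simp: mem_unit_ball)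
  then have "0 < sqrt (2 * \<omega> e)" by simp
  then show "0 < \<Omega>" using up[OF \<open>e \<in> ?B\<close>] by linarith
  obtain v where v: "\<And>s. v s \<in> ?B"
    and max: "\<And>s y. y \<in> ?B \<Longrightarrow> s \<bullet> y - \<omega> y \<le> s \<bullet> v s - \<omega> (v s) - (nrm (y - v s))\<^sup>2 / 2"
    using mirror_map_exists by metis
  obtain c where c: "c > 0" "\<And>x. c * norm x \<le> nrm x" using nrm_bounds_norm by blast
  \<comment> \<open>Adding the gap inequalities of two maximizers, each tested at the other one.\<close>
  have lip: "norm (v s - v s') \<le> norm (s - s') / c\<^sup>2" for s s'
  proof -
    have "(nrm (v s - v s'))\<^sup>2 \<le> (s - s') \<bullet> (v s - v s')"
      using max[OF v, of s' s] max[OF v, of s s'] nrm_diff_swap[of "v s" "v s'"]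
      by (simp add: inner_diff_left inner_diff_right)
    moreover have "c\<^sup>2 * norm (v s - v s') * norm (v s - v s') \<le> (nrm (v s - v s'))\<^sup>2"
      using power_mono[OF c(2)[of "v s - v s'"], of 2] c(1)
      by (simp add: power_mult_distrib power2_eq_square mult.assoc mult.left_commute)
    moreover have "(s - s') \<bullet> (v s - v s') \<le> norm (s - s') * norm (v s - v s')"
      by (rule norm_cauchy_schwarz)
    ultimately have "c\<^sup>2 * norm (v s - v s') * norm (v s - v s') \<le> norm (s - s') * norm (v s - v s')"
      by linarith
    then have "c\<^sup>2 * norm (v s - v s') \<le> norm (s - s')"
      by (cases "v s = v s'") (simp_all add: mult_le_cancel_right)
    then show ?thesis using c(1) by (simp add: field_simps)
  qed
  have "continuous_on UNIV v"
  proof (rule lipschitz_on_continuous_on)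
    show "lipschitz_on (1 / c\<^sup>2) UNIV v"
      using lip by (intro lipschitz_onI) (auto simp: dist_norm)
  qed
  have regret: "s \<bullet> y - \<omega> y \<le> (\<Sum>t=1..n. v (\<Sum>u=1..<t. D u) \<bullet> D t) + (\<Sum>t=1..n. (dual_norm nrm (D t))\<^sup>2) / 2"
    if "y \<in> ?B" "s = (\<Sum>t=1..n. D t)" for D :: "nat \<Rightarrow> 'a" and n s y
    using that
  proof (induction n arbitrary: s y)
    case 0
    have "0 \<le> \<omega> y" using lower[OF 0(1)] zero_le_power2[of "nrm y"] by linarith
    then show ?case using 0 by simp
  next
    case (Suc n)
    define p where "p = (\<Sum>t=1..n. D t)"
    define \<delta> where "\<delta> = D (Suc n)"
    have p: "(\<Sum>u=1..<Suc n. D u) = p"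
      by (simp add: p_def atLeastLessThanSuc_atLeastAtMost)
    have s: "s = p + \<delta>" using Suc.prems by (simp add: p_def \<delta>_def)
    have "\<delta> \<bullet> (y - v p) \<le> nrm (y - v p) * dual_norm nrm \<delta>"
      using inner_le_nrm_dual_norm[of "y - v p" \<delta>] by (simp add: inner_commute)
    also have "\<dots> \<le> (nrm (y - v p))\<^sup>2 / 2 + (dual_norm nrm \<delta>)\<^sup>2 / 2"
      using sum_squares_bound[of "nrm (y - v p)" "dual_norm nrm \<delta>"] by simp
    finally have "s \<bullet> y - \<omega> y \<le> (p \<bullet> v p - \<omega> (v p)) + v p \<bullet> \<delta> + (dual_norm nrm \<delta>)\<^sup>2 / 2"
      using max[OF Suc.prems(1), of p]
      by (simp add: s inner_add_left inner_diff_right inner_commute[of "v p" \<delta>])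
    then show ?case using Suc.IH[OF v p_def, of p] p
      by (simp add: \<delta>_def[symmetric] add_divide_distrib)
  qed
  have "y \<bullet> (\<Sum>t=1..n. D t) \<le> \<Omega>\<^sup>2 / 2 + (\<Sum>t=1..n. v (\<Sum>u=1..<t. D u) \<bullet> D t)
      + (\<Sum>t=1..n. (dual_norm nrm (D t))\<^sup>2) / 2" if "nrm y \<le> 1" for D :: "nat \<Rightarrow> 'a" and n y
    using upper[of y] regret[of y _ D n, OF _ refl] that
    by (simp add: mem_unit_ball inner_commute[of y])
  then have "dual_norm nrm (\<Sum>t=1..n. D t) \<le> \<Omega>\<^sup>2 / 2 + (\<Sum>t=1..n. v (\<Sum>u=1..<t. D u) \<bullet> D t)
      + (\<Sum>t=1..n. (dual_norm nrm (D t))\<^sup>2) / 2" for D :: "nat \<Rightarrow> 'a" and n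
    by (rule dual_norm_least)
  moreover have "\<forall>s. nrm (v s) \<le> 1" using v by (simp add: mem_unit_ball)
  ultimately show "\<exists>v. continuous_on UNIV v \<and> (\<forall>s. nrm (v s) \<le> 1) \<and>
      (\<forall>(D :: nat \<Rightarrow> 'a) n. dual_norm nrm (\<Sum>t=1..n. D t) \<le>
         \<Omega>\<^sup>2 / 2 + (\<Sum>t=1..n. v (\<Sum>u=1..<t. D u) \<bullet> D t) + (\<Sum>t=1..n. (dual_norm nrm (D t))\<^sup>2) / 2)"
    using \<open>continuous_on UNIV v\<close> by blast
qed

end
end

section \<open>The constant in the moment bound\<close>

text \<open>The set whose least element is \<^const>\<open>tau_star\<close> contains \<open>1\<close>.\<close>

lemma exp_le_add_exp_square: "exp t \<le> t + exp (t\<^sup>2)" for t :: real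
proof -
  have sq: "1 + t\<^sup>2 \<le> exp (t\<^sup>2)" by (rule exp_ge_add_one_self)
  consider "1 \<le> t" | "0 \<le> t" "t \<le> 1" | "t \<le> 0" by linarith
  then show ?thesis
  proof cases
    case 1
    then have "t \<le> t\<^sup>2" by (simp add: power2_eq_square)
    then have "exp t \<le> exp (t\<^sup>2)" by simp
    with 1 show ?thesis by linarith
  next
    case 2
    then show ?thesis using exp_bound[of t] sq by linarith
  next
    case 3
    have "1 \<le> (1 - t) * (1 + t + t\<^sup>2)"
      using 3 by (simp add: algebra_simps power2_eq_square mult_nonpos_nonneg)
    moreover have "0 \<le> 1 + t + t\<^sup>2"
      using zero_le_power2[of "t + 1/2"] by (simp add: power2_eq_square algebra_simps)
    ultimately have "1 \<le> exp (- t) * (1 + t + t\<^sup>2)"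
      using mult_right_mono[OF exp_ge_add_one_self[of "- t"], of "1 + t + t\<^sup>2"] by simp
    then have "exp t \<le> 1 + t + t\<^sup>2" by (simp add: exp_minus field_simps)
    then show ?thesis using sq by linarith
  qed
qed

text \<open>
  For each nonzero \<^term>\<open>t\<close> the condition on \<open>\<tau>\<close> is a lower bound on \<open>\<tau>\<close>, by a logarithm, so it passes
  to the infimum, which is therefore attained. The bound for \<open>t = 1\<close> keeps the infimum away from
  zero.
\<close>

lemma tau_star_pos: "0 < tau_star"
  and exp_le_tau_star: "exp t \<le> t + exp (tau_star * t\<^sup>2)"
proof -
  let ?S = "{\<tau>::real. 0 < \<tau> \<and> (\<forall>t::real. exp t \<le> t + exp (\<tau> * t\<^sup>2))}"
  have ln_le_iff: "ln x \<le> y \<longleftrightarrow> x \<le> exp y" if "0 < x" for x y :: real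
    using that by (metis exp_ln exp_le_cancel_iff)
  define b :: real where "b = ln (exp 1 - 1)"
  have e2: "2 \<le> exp (1::real)" using exp_ge_add_one_self[of 1] by simp
  have "exp (1::real) \<noteq> 2"
    using exp_lower_Taylor_quadratic[of "1::real"] by simp
  then have b: "0 < b" unfolding b_def using e2 by simp
  have lb: "b \<le> \<tau>" if "\<tau> \<in> ?S" for \<tau>
  proof -
    have "exp 1 - 1 \<le> exp \<tau>" using that by (auto dest: spec[of _ 1])
    then show ?thesis unfolding b_def using e2 by (simp add: ln_le_iff)
  qed
  have ne: "1 \<in> ?S" using exp_le_add_exp_square by simp
  have bdd: "bdd_below ?S" using lb by (auto intro!: bdd_belowI[of _ b])
  have inf: "b \<le> Inf ?S" by (rule cInf_greatest) (use ne lb in blast)+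
  have "exp t \<le> t + exp (Inf ?S * t\<^sup>2)" for t :: real
  proof (cases "t = 0")
    case False
    show ?thesis
    proof (cases "exp t \<le> t")
      case True
      then show ?thesis using exp_ge_zero[of "Inf ?S * t\<^sup>2"] by linarith
    next
      case gt: False
      have "ln (exp t - t) / t\<^sup>2 \<le> \<tau>" if "\<tau> \<in> ?S" for \<tau>
      proof -
        have "exp t - t \<le> exp (\<tau> * t\<^sup>2)" using that by (auto dest: spec[of _ t])
        then have "ln (exp t - t) \<le> \<tau> * t\<^sup>2" using gt by (simp add: ln_le_iff)
        then show ?thesis using False by (simp add: field_simps)
      qed
      then have "ln (exp t - t) / t\<^sup>2 \<le> Inf ?S" by (intro cInf_greatest) (use ne in blast)+
      then have "ln (exp t - t) \<le> Inf ?S * t\<^sup>2" using False by (simp add: field_simps)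
      then show ?thesis using gt by (simp add: ln_le_iff)
    qed
  qed simp
  with b inf have mem: "Inf ?S \<in> ?S" by auto
  have "tau_star = Inf ?S" unfolding tau_star_def
    using mem cInf_lower[OF _ bdd] by (intro Least_equality) auto
  with mem show "0 < tau_star" "exp t \<le> t + exp (tau_star * t\<^sup>2)" by auto
qed

section \<open>Exponential moments and tails\<close>

lemma (in prob_space) integrable_of_exp_square:
  assumes [measurable]: "Y \<in> borel_measurable M"
    and "(\<integral>\<^sup>+z. ennreal (exp ((Y z)\<^sup>2)) \<partial>M) \<le> ennreal (exp 1)"
  shows "integrable M (\<lambda>z. exp ((Y z)\<^sup>2))" and "(\<integral>z. exp ((Y z)\<^sup>2) \<partial>M) \<le> exp 1"
proof -
  show int: "integrable M (\<lambda>z. exp ((Y z)\<^sup>2))"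
    using assms(2) by (intro integrableI_nonneg) (auto simp: top_unique less_top[symmetric])
  show "(\<integral>z. exp ((Y z)\<^sup>2) \<partial>M) \<le> exp 1"
    using assms(2) by (subst (asm) nn_integral_eq_integral[OF int]) auto
qed

text \<open>
  In \<open>exp (\<kappa> * Y) \<le> \<kappa> * Y + exp (tau_star * \<kappa>\<^sup>2 * Y\<^sup>2)\<close> the linear term has mean
  zero. With \<open>p = tau_star * \<kappa>\<^sup>2\<close> in the unit interval, convexity of the exponential gives
  \<open>exp (p * (u - 1)) \<le> 1 - p + p * exp (u - 1)\<close>. At \<open>u = Y\<^sup>2\<close> the right side has
  mean at most \<open>1\<close>, so it replaces Jensen's inequality for the power \<open>p\<close>.
\<close>

lemma (in prob_space) mgf_bound:
  assumes [measurable]: "Y \<in> borel_measurable M"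
    and Y: "integrable M Y" "expectation Y = 0"
    and light: "(\<integral>\<^sup>+z. ennreal (exp ((Y z)\<^sup>2)) \<partial>M) \<le> ennreal (exp 1)"
    and \<kappa>: "tau_star * \<kappa>\<^sup>2 \<le> 1"
  shows "(\<integral>\<^sup>+z. ennreal (exp (\<kappa> * Y z)) \<partial>M) \<le> ennreal (exp (tau_star * \<kappa>\<^sup>2))"
proof -
  define p where "p = tau_star * \<kappa>\<^sup>2"
  have p: "0 \<le> p" "p \<le> 1" using \<kappa> tau_star_pos by (auto simp: p_def)
  note int = integrable_of_exp_square[OF assms(1) light]
  define H where "H z = \<kappa> * Y z + exp p * (1 - p) + (exp p * p / exp 1) * exp ((Y z)\<^sup>2)" for z
  have bound: "exp (\<kappa> * Y z) \<le> H z" for z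
  proof -
    have tau: "exp (\<kappa> * Y z) \<le> \<kappa> * Y z + exp (p * (Y z)\<^sup>2)"
      using exp_le_tau_star[of "\<kappa> * Y z"] by (simp add: p_def power_mult_distrib mult.assoc)
    have "exp (p * ((Y z)\<^sup>2 - 1)) \<le> (1 - p) * exp 0 + p * exp ((Y z)\<^sup>2 - 1)"
      using convex_onD[OF exp_convex, of p 0 "(Y z)\<^sup>2 - 1"] p by simp
    then have "exp p * exp (p * ((Y z)\<^sup>2 - 1)) \<le> exp p * ((1 - p) + p * exp ((Y z)\<^sup>2 - 1))"
      by simp
    moreover have "exp p * exp (p * ((Y z)\<^sup>2 - 1)) = exp (p * (Y z)\<^sup>2)"
      unfolding mult_exp_exp by (simp add: algebra_simps)
    moreover have "exp p * ((1 - p) + p * exp ((Y z)\<^sup>2 - 1))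
        = exp p * (1 - p) + (exp p * p / exp 1) * exp ((Y z)\<^sup>2)"
      unfolding exp_diff by (simp add: algebra_simps)
    ultimately show ?thesis using tau unfolding H_def by linarith
  qed
  have intH: "integrable M H" unfolding H_def using Y int by auto
  have "expectation H = exp p * (1 - p) + (exp p * p / exp 1) * expectation (\<lambda>z. exp ((Y z)\<^sup>2))"
    unfolding H_def using Y int by (simp add: prob_space)
  also have "\<dots> \<le> exp p * (1 - p) + (exp p * p / exp 1) * exp 1"
    using int(2) p by (intro add_left_mono mult_left_mono) auto
  also have "\<dots> = exp p" by (simp add: algebra_simps)
  finally have E: "expectation H \<le> exp p" .
  have "(\<integral>\<^sup>+z. ennreal (exp (\<kappa> * Y z)) \<partial>M) \<le> (\<integral>\<^sup>+z. ennreal (H z) \<partial>M)"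
    by (intro nn_integral_mono ennreal_leI bound)
  also have "\<dots> = ennreal (expectation H)"
    using order_trans[OF exp_ge_zero bound] by (intro nn_integral_eq_integral[OF intH]) auto
  finally show ?thesis using E unfolding p_def by (auto intro: order_trans ennreal_leI)
qed

text \<open>
  The last factor integrates to at most \<^term>\<open>C\<close> whatever the past is, so integrating the coordinates
  from the last to the first yields one factor \<^term>\<open>C\<close> each. The past enters only through the partial
  sum of \<^term>\<open>D\<close>, which is all that dual averaging uses of it.
\<close>

lemma nn_integral_PiM_predictable:
  fixes D :: "'b \<Rightarrow> 'a::euclidean_space" and \<phi> :: "'a \<Rightarrow> 'b \<Rightarrow> ennreal"
  assumes "prob_space P"
    and [measurable]: "D \<in> borel_measurable P" "(\<lambda>(s, z). \<phi> s z) \<in> borel_measurable (borel \<Otimes>\<^sub>M P)"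
    and C: "\<And>s. (\<integral>\<^sup>+z. \<phi> s z \<partial>P) \<le> C"
  shows "(\<integral>\<^sup>+x. (\<Prod>t=1..n. \<phi> (\<Sum>u=1..<t. D (x u)) (x t)) \<partial>PiM {1..n} (\<lambda>_. P)) \<le> C ^ n"
proof -
  interpret P: prob_space P by fact
  interpret product_sigma_finite "\<lambda>_::nat. P" by standard
  show ?thesis
  proof (induction n)
    case 0
    interpret PiM0: prob_space "PiM {} (\<lambda>_::nat. P)" by (rule prob_space_PiM) (rule assms)
    show ?case using PiM0.emeasure_space_1 by simp
  next
    case (Suc n)
    have ins: "{1..Suc n} = insert (Suc n) {1..n}" by auto
    let ?\<Pi> = "PiM {1..n} (\<lambda>_. P)"
    let ?A = "\<lambda>x. \<Prod>t=1..n. \<phi> (\<Sum>u=1..<t. D (x u)) (x t)"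
    let ?S = "\<lambda>x. \<Sum>u=1..<Suc n. D (x u)"
    have S: "(\<lambda>x. \<Sum>u=1..<t. D (x u)) \<in> borel_measurable (PiM {1..j} (\<lambda>_. P))"
      if "t \<le> Suc j" for t j :: nat
    proof (rule borel_measurable_sum)
      fix u assume "u \<in> {1..<t}"
      then have "u \<in> {1..j}" using that by auto
      then show "(\<lambda>x. D (x u)) \<in> borel_measurable (PiM {1..j} (\<lambda>_. P))" by measurable
    qed
    have meas: "(\<lambda>x. \<Prod>t=1..k. \<phi> (\<Sum>u=1..<t. D (x u)) (x t)) \<in> borel_measurable (PiM {1..j} (\<lambda>_. P))"
      if "k \<le> j" for j k :: nat
    proof (rule borel_measurable_prod_ennreal)
      fix t assume "t \<in> {1..k}"
      then have "t \<in> {1..j}" using that by auto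
      then have "(\<lambda>x. (\<Sum>u=1..<t. D (x u), x t)) \<in> measurable (PiM {1..j} (\<lambda>_. P)) (borel \<Otimes>\<^sub>M P)"
        by (intro measurable_Pair S measurable_component_singleton) auto
      from measurable_compose[OF this assms(3)]
      show "(\<lambda>x. \<phi> (\<Sum>u=1..<t. D (x u)) (x t)) \<in> borel_measurable (PiM {1..j} (\<lambda>_. P))" by simp
    qed
    have "(\<integral>\<^sup>+x. (\<Prod>t=1..Suc n. \<phi> (\<Sum>u=1..<t. D (x u)) (x t)) \<partial>PiM {1..Suc n} (\<lambda>_. P))
        = (\<integral>\<^sup>+x. (\<integral>\<^sup>+z. (\<Prod>t=1..Suc n. \<phi> (\<Sum>u=1..<t. D ((x(Suc n := z)) u)) ((x(Suc n := z)) t)) \<partial>P) \<partial>?\<Pi>)"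
      unfolding ins by (rule product_nn_integral_insert[OF _ _ meas[of "Suc n" "Suc n", unfolded ins]]) auto
    also have "\<dots> = (\<integral>\<^sup>+x. (\<integral>\<^sup>+z. ?A x * \<phi> (?S x) z \<partial>P) \<partial>?\<Pi>)"
    proof (intro nn_integral_cong)
      fix x z
      have past: "(\<Sum>u=1..<t. D ((x(Suc n := z)) u)) = (\<Sum>u=1..<t. D (x u))" if "t \<le> Suc n" for t
        using that by (intro sum.cong) auto
      have "(\<Prod>t=1..n. \<phi> (\<Sum>u=1..<t. D ((x(Suc n := z)) u)) ((x(Suc n := z)) t)) = ?A x"
        by (intro prod.cong refl) (subst past, auto)
      then show "(\<Prod>t=1..Suc n. \<phi> (\<Sum>u=1..<t. D ((x(Suc n := z)) u)) ((x(Suc n := z)) t))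
          = ?A x * \<phi> (?S x) z"
        by (simp only: prod.cl_ivl_Suc past[OF order_refl] fun_upd_same) simp
    qed
    also have "\<dots> = (\<integral>\<^sup>+x. ?A x * (\<integral>\<^sup>+z. \<phi> (?S x) z \<partial>P) \<partial>?\<Pi>)"
      by (intro nn_integral_cong nn_integral_cmult measurable_Pair2[OF assms(3), simplified]) auto
    also have "\<dots> \<le> (\<integral>\<^sup>+x. ?A x * C \<partial>?\<Pi>)"
      by (intro nn_integral_mono mult_left_mono C) auto
    also have "\<dots> = (\<integral>\<^sup>+x. ?A x \<partial>?\<Pi>) * C"
      by (intro nn_integral_multc meas) auto
    also have "\<dots> \<le> C ^ n * C" by (intro mult_right_mono Suc.IH) auto
    finally show ?case by (simp add: mult.commute)
  qed
qed

text \<open>Markov's inequality for the exponential of the sum.\<close>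

lemma (in prob_space) tail_predictable:
  fixes \<xi> :: "nat \<Rightarrow> 'a \<Rightarrow> 'b::topological_space" and D :: "'b \<Rightarrow> 'c::euclidean_space"
    and \<psi> :: "'c \<Rightarrow> 'b \<Rightarrow> real"
  assumes indep: "indep_vars (\<lambda>_. borel) \<xi> {1..}" and law: "\<And>t. t \<ge> 1 \<Longrightarrow> distr M borel (\<xi> t) = P"
    and [measurable]: "D \<in> borel_measurable borel"
      "(\<lambda>(s, z). \<psi> s z) \<in> borel_measurable (borel \<Otimes>\<^sub>M borel)"
    and C: "\<And>s. (\<integral>\<^sup>+z. ennreal (exp (\<psi> s z)) \<partial>P) \<le> ennreal (exp c)"
    and n: "0 < n"
  shows "prob {w \<in> space M. a < (\<Sum>t=1..n. \<psi> (\<Sum>u=1..<t. D (\<xi> u w)) (\<xi> t w))} \<le> exp (n * c - a)"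
proof -
  have \<xi>[measurable]: "\<xi> t \<in> measurable M borel" if "t \<ge> 1" for t
    using indep that by (auto simp: indep_vars_def)
  have P: "prob_space P" "sets P = sets borel"
    using law[of 1] prob_space_distr[OF \<xi>[of 1]] by auto
  note [measurable_cong] = P(2)
  have "indep_vars (\<lambda>_. borel) \<xi> {1..n}"
    by (rule indep_vars_subset[OF indep]) auto
  then have dist: "distr M (\<Pi>\<^sub>M i\<in>{1..n}. borel) (\<lambda>w. \<lambda>i\<in>{1..n}. \<xi> i w) = PiM {1..n} (\<lambda>_. P)"
    using n law by (subst (asm) indep_vars_iff_distr_eq_PiM') (auto intro!: PiM_cong)
  let ?S = "\<lambda>x. \<Sum>t=1..n. \<psi> (\<Sum>u=1..<t. D (x u)) (x t)"
  have [measurable]: "(\<lambda>x. x t) \<in> measurable (PiM {1..n} (\<lambda>_. borel :: 'b measure)) borel" if "t \<in> {1..n}" for t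
    using that by measurable
  have S[measurable]: "?S \<in> borel_measurable (PiM {1..n} (\<lambda>_. borel))"
  proof (rule borel_measurable_sum)
    fix t assume t: "t \<in> {1..n}"
    have "(\<lambda>x. \<Sum>u=1..<t. D (x u)) \<in> borel_measurable (PiM {1..n} (\<lambda>_. borel))"
      using t by (intro borel_measurable_sum) measurable
    with t show "(\<lambda>x. \<psi> (\<Sum>u=1..<t. D (x u)) (x t)) \<in> borel_measurable (PiM {1..n} (\<lambda>_. borel))"
      by measurable
  qed
  let ?T = "\<lambda>w. ?S (\<lambda>i\<in>{1..n}. \<xi> i w)"
  have restrict[measurable]: "(\<lambda>w. \<lambda>i\<in>{1..n}. \<xi> i w) \<in> measurable M (PiM {1..n} (\<lambda>_. borel))"
    by (intro measurable_restrict) auto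
  have eq: "(\<Sum>t=1..n. \<psi> (\<Sum>u=1..<t. D (\<xi> u w)) (\<xi> t w)) = ?T w" for w
    by (intro sum.cong arg_cong2[of _ _ _ _ \<psi>]) auto
  have "(\<integral>\<^sup>+w. ennreal (exp (?T w)) \<partial>M) = (\<integral>\<^sup>+x. ennreal (exp (?S x)) \<partial>PiM {1..n} (\<lambda>_. P))"
    unfolding dist[symmetric] by (subst nn_integral_distr) auto
  also have "\<dots> = (\<integral>\<^sup>+x. (\<Prod>t=1..n. ennreal (exp (\<psi> (\<Sum>u=1..<t. D (x u)) (x t)))) \<partial>PiM {1..n} (\<lambda>_. P))"
    by (simp add: exp_sum prod_ennreal)
  also have "\<dots> \<le> ennreal (exp c) ^ n"
  proof (rule nn_integral_PiM_predictable[OF P(1)])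
    show "(\<lambda>(s, z). ennreal (exp (\<psi> s z))) \<in> borel_measurable (borel \<Otimes>\<^sub>M P)"
      using measurable_compose[OF assms(4), of "\<lambda>r. ennreal (exp r)" borel]
      by (simp add: split_beta')
  qed (use C in \<open>auto simp: measurable_cong_sets[OF P(2) refl]\<close>)
  also have "\<dots> = ennreal (exp (n * c))"
    by (simp add: ennreal_power exp_of_nat_mult)
  finally have mgf: "(\<integral>\<^sup>+w. ennreal (exp (?T w)) \<partial>M) \<le> ennreal (exp (n * c))" .
  have "emeasure M {w \<in> space M. a < ?T w} \<le> emeasure M {w \<in> space M. 1 \<le> ennreal (exp (- a)) * ennreal (exp (?T w))}"
    by (intro emeasure_mono) (auto simp: ennreal_mult[symmetric] exp_add[symmetric])
  also have "\<dots> \<le> ennreal (exp (- a)) * (\<integral>\<^sup>+w. ennreal (exp (?T w)) * indicator (space M) w \<partial>M)"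
    by (rule nn_integral_Markov_inequality) measurable
  also have "\<dots> \<le> ennreal (exp (- a)) * ennreal (exp (n * c))"
  proof -
    have "(\<integral>\<^sup>+w. ennreal (exp (?T w)) * indicator (space M) w \<partial>M) = (\<integral>\<^sup>+w. ennreal (exp (?T w)) \<partial>M)"
      by (intro nn_integral_cong) (simp only: indicator_simps mult_1_right)
    then show ?thesis using mult_left_mono[OF mgf zero_le] by (simp only:)
  qed
  also have "\<dots> = ennreal (exp (n * c - a))"
    by (simp add: ennreal_mult[symmetric] exp_add[symmetric])
  finally show ?thesis unfolding eq by (simp add: emeasure_eq_measure)
qed

text \<open>
  The exponent \<open>n * tau_star * \<kappa>\<^sup>2 - \<kappa> * lam * sqrt n\<close> of the Chernoff bound is
  minimal at \<open>\<kappa> = lam / (2 * tau_star * sqrt n)\<close>. The upper limit on \<^term>\<open>lam\<close> says exactly that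
  this \<open>\<kappa>\<close> satisfies the condition of the moment bound.
\<close>

lemma (in prob_space) tail_predictable_mean_zero:
  fixes \<xi> :: "nat \<Rightarrow> 'a \<Rightarrow> 'b::topological_space" and D :: "'b \<Rightarrow> 'c::euclidean_space"
    and \<psi> :: "'c \<Rightarrow> 'b \<Rightarrow> real"
  assumes indep: "indep_vars (\<lambda>_. borel) \<xi> {1..}" and law: "\<And>t. t \<ge> 1 \<Longrightarrow> distr M borel (\<xi> t) = P"
    and P: "prob_space P"
    and D: "D \<in> borel_measurable borel"
    and \<psi>: "(\<lambda>(s, z). \<psi> s z) \<in> borel_measurable (borel \<Otimes>\<^sub>M borel)"
    and mean: "\<And>s. integrable P (\<psi> s)" "\<And>s. (\<integral>z. \<psi> s z \<partial>P) = 0"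
    and light: "\<And>s. (\<integral>\<^sup>+z. ennreal (exp ((\<psi> s z)\<^sup>2)) \<partial>P) \<le> ennreal (exp 1)"
    and n: "0 < n" and lam: "lam \<in> {0 .. 2 * sqrt (tau_star * real n)}"
  shows "prob {w \<in> space M. lam * sqrt n < (\<Sum>t=1..n. \<psi> (\<Sum>u=1..<t. D (\<xi> u w)) (\<xi> t w))}
    \<le> exp (- (lam\<^sup>2 / (4 * tau_star)))"
proof (cases "lam = 0")
  case False
  define \<kappa> where "\<kappa> = lam / (2 * tau_star * sqrt n)"
  have pos: "0 < \<kappa>" using False lam n tau_star_pos by (auto simp: \<kappa>_def)
  have \<kappa>2: "tau_star * \<kappa>\<^sup>2 = lam\<^sup>2 / (4 * tau_star) / n"
    using n tau_star_pos by (simp add: \<kappa>_def power_divide power_mult_distrib power2_eq_square)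
  have "lam\<^sup>2 \<le> (2 * sqrt (tau_star * n))\<^sup>2" using lam by (intro power_mono) auto
  also have "\<dots> = 4 * tau_star * n" using tau_star_pos by (simp add: power_mult_distrib)
  finally have "tau_star * \<kappa>\<^sup>2 \<le> 1"
    using n tau_star_pos by (simp add: \<kappa>2 field_simps)
  then have mgf: "(\<integral>\<^sup>+z. ennreal (exp (\<kappa> * \<psi> s z)) \<partial>P) \<le> ennreal (exp (tau_star * \<kappa>\<^sup>2))" for s
    using mean light by (intro prob_space.mgf_bound[OF P]) auto
  have "{w \<in> space M. lam * sqrt n < (\<Sum>t=1..n. \<psi> (\<Sum>u=1..<t. D (\<xi> u w)) (\<xi> t w))}
      = {w \<in> space M. \<kappa> * (lam * sqrt n) < (\<Sum>t=1..n. \<kappa> * \<psi> (\<Sum>u=1..<t. D (\<xi> u w)) (\<xi> t w))}"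
    using pos by (simp add: sum_distrib_left[symmetric])
  also have "prob \<dots> \<le> exp (n * (tau_star * \<kappa>\<^sup>2) - \<kappa> * (lam * sqrt n))"
  proof (rule tail_predictable[OF indep law D _ mgf n])
    show "(\<lambda>(s, z). \<kappa> * \<psi> s z) \<in> borel_measurable (borel \<Otimes>\<^sub>M borel)"
      using borel_measurable_times[OF borel_measurable_const \<psi>, of \<kappa>] by (simp add: split_beta')
  qed
  also have "n * (tau_star * \<kappa>\<^sup>2) - \<kappa> * (lam * sqrt n) = - (lam\<^sup>2 / (4 * tau_star))"
    using n tau_star_pos unfolding \<kappa>2 by (simp add: \<kappa>_def field_simps power2_eq_square)
  finally show ?thesis .
qed simp

text \<open>
  Dual averaging is applied to the vectors scaled by \<open>\<kappa>\<close>. After division by \<open>\<kappa>\<close>, and as long as the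
  squared norms add up to at most \<open>n * s\<^sup>2\<close> and the predictable inner products to at most
  \<open>lam * sqrt n\<close>, the bound is
  \<open>\<Omega>\<^sup>2 / (2 * \<kappa>) + \<kappa> * n * s\<^sup>2 / 2 + lam * sqrt n\<close>. The choice
  \<open>\<kappa> = \<Omega> / sqrt n\<close> turns it into the stated one. The two exceptional events account for the two exponentials.
\<close>

lemma (in prob_space) tail_dual_norm_sum:
  fixes \<xi> :: "nat \<Rightarrow> 'a \<Rightarrow> 'b::topological_space" and D :: "'b \<Rightarrow> 'c::euclidean_space"
  assumes nrm: "is_norm nrm" and C1: "C1_on_ball_with_gradient nrm \<omega> grad\<omega>"
    and strong: "\<And>x y. x \<in> unit_ball nrm \<Longrightarrow> y \<in> unit_ball nrm \<Longrightarrow>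
           (grad\<omega> x - grad\<omega> y) \<bullet> (x - y) \<ge> (nrm (x - y))\<^sup>2"
    and \<omega>0: "\<omega> 0 = 0" "grad\<omega> 0 = 0" and \<Omega>: "\<Omega> = (SUP x\<in>unit_ball nrm. sqrt (2 * \<omega> x))"
    and indep: "indep_vars (\<lambda>_. borel) \<xi> {1..}" and law: "\<And>t. t \<ge> 1 \<Longrightarrow> distr M borel (\<xi> t) = P"
    and P: "prob_space P" "sets P = sets borel"
    and D: "integrable P D" "(\<integral>z. D z \<partial>P) = 0"
    and light: "(\<integral>\<^sup>+z. ennreal (exp ((dual_norm nrm (D z))\<^sup>2)) \<partial>P) \<le> ennreal (exp 1)"
    and n: "0 < n" and lam: "lam \<in> {0 .. 2 * sqrt (tau_star * real n)}"
  shows "{w \<in> space M. sqrt n * (\<Omega> / 2 * (1 + s\<^sup>2) + lam) < dual_norm nrm (\<Sum>t=1..n. D (\<xi> t w))} \<in> events"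
    and "prob {w \<in> space M. sqrt n * (\<Omega> / 2 * (1 + s\<^sup>2) + lam) < dual_norm nrm (\<Sum>t=1..n. D (\<xi> t w))}
      \<le> exp (- (n * (s\<^sup>2 - 1))) + exp (- (lam\<^sup>2 / (4 * tau_star)))"
proof -
  have \<Omega>_pos: "0 < \<Omega>"
    by (rule dual_averaging_regret(1)[OF nrm C1 strong \<omega>0 \<Omega>])
  obtain v where v_cont: "continuous_on UNIV v" and v: "\<And>s. nrm (v s) \<le> 1"
    and regret: "\<And>(E :: nat \<Rightarrow> 'c) n. dual_norm nrm (\<Sum>t=1..n. E t) \<le>
         \<Omega>\<^sup>2 / 2 + (\<Sum>t=1..n. v (\<Sum>u=1..<t. E u) \<bullet> E t) + (\<Sum>t=1..n. (dual_norm nrm (E t))\<^sup>2) / 2"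
    using dual_averaging_regret(2)[OF nrm C1 strong \<omega>0 \<Omega>] by blast
  have v_meas[measurable]: "v \<in> borel_measurable borel"
    by (rule borel_measurable_continuous_onI[OF v_cont])
  have D_meas[measurable]: "D \<in> borel_measurable borel"
    using borel_measurable_integrable[OF D(1)] by (simp add: measurable_cong_sets[OF P(2) refl])
  note [measurable] = borel_measurable_dual_norm[OF nrm]
  have \<xi>_meas[measurable]: "\<xi> t \<in> measurable M borel" if "t \<in> {1..n}" for t
    using indep that by (auto simp: indep_vars_def)
  define \<kappa> where "\<kappa> = \<Omega> / sqrt n"
  have \<kappa>: "0 < \<kappa>" using \<Omega>_pos n by (simp add: \<kappa>_def)
  define A1 where "A1 = {w \<in> space M. n * s\<^sup>2 < (\<Sum>t=1..n. (dual_norm nrm (D (\<xi> t w)))\<^sup>2)}"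
  define A2 where "A2 = {w \<in> space M. lam * sqrt n < (\<Sum>t=1..n. v (\<Sum>u=1..<t. \<kappa> *\<^sub>R D (\<xi> u w)) \<bullet> D (\<xi> t w))}"
  have ev1: "A1 \<in> events" unfolding A1_def by measurable
  have ev2: "A2 \<in> events"
  proof -
    have "(\<lambda>w. v (\<Sum>u=1..<t. \<kappa> *\<^sub>R D (\<xi> u w)) \<bullet> D (\<xi> t w)) \<in> borel_measurable M" if t: "t \<in> {1..n}" for t
    proof -
      have "(\<lambda>w. \<Sum>u=1..<t. \<kappa> *\<^sub>R D (\<xi> u w)) \<in> borel_measurable M"
        using t by (intro borel_measurable_sum) measurable
      then show ?thesis using t by measurable
    qed
    then show ?thesis unfolding A2_def by measurable
  qed
  show "{w \<in> space M. sqrt n * (\<Omega> / 2 * (1 + s\<^sup>2) + lam) < dual_norm nrm (\<Sum>t=1..n. D (\<xi> t w))} \<in> events"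
    by measurable
  have "prob A1 \<le> exp (real n * 1 - real n * s\<^sup>2)"
    unfolding A1_def
    by (rule tail_predictable[where \<psi> = "\<lambda>s z. (dual_norm nrm (D z))\<^sup>2",
          OF indep law D_meas _ light n]) measurable
  then have p1: "prob A1 \<le> exp (- (n * (s\<^sup>2 - 1)))" by (simp add: algebra_simps)
  have vD: "(v s \<bullet> D z)\<^sup>2 \<le> (dual_norm nrm (D z))\<^sup>2" for s z
    using abs_inner_le_dual_norm[OF nrm v] by (simp add: abs_le_square_iff[symmetric] dual_norm_nonneg[OF nrm])
  have p2: "prob A2 \<le> exp (- (lam\<^sup>2 / (4 * tau_star)))"
    unfolding A2_def
  proof (rule tail_predictable_mean_zero[OF indep law P(1) _ _ _ _ _ n lam])
    show "(\<lambda>z. \<kappa> *\<^sub>R D z) \<in> borel_measurable borel" by measurable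
    show "(\<lambda>(s, z). v s \<bullet> D z) \<in> borel_measurable (borel \<Otimes>\<^sub>M borel)" by measurable
    show "integrable P (\<lambda>z. v s \<bullet> D z)" "(\<integral>z. v s \<bullet> D z \<partial>P) = 0" for s
      using D by (auto simp: integral_inner_right)
    have "(\<integral>\<^sup>+z. ennreal (exp ((v s \<bullet> D z)\<^sup>2)) \<partial>P) \<le> (\<integral>\<^sup>+z. ennreal (exp ((dual_norm nrm (D z))\<^sup>2)) \<partial>P)" for s
      using vD by (intro nn_integral_mono ennreal_leI) simp
    then show "(\<integral>\<^sup>+z. ennreal (exp ((v s \<bullet> D z)\<^sup>2)) \<partial>P) \<le> ennreal (exp 1)" for s
      using light by (rule order_trans)
  qed
  have "{w \<in> space M. sqrt n * (\<Omega> / 2 * (1 + s\<^sup>2) + lam) < dual_norm nrm (\<Sum>t=1..n. D (\<xi> t w))} \<subseteq> A1 \<union> A2"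
  proof (rule subsetI, rule ccontr)
    fix w assume w: "w \<in> {w \<in> space M. sqrt n * (\<Omega> / 2 * (1 + s\<^sup>2) + lam) < dual_norm nrm (\<Sum>t=1..n. D (\<xi> t w))}"
      and "w \<notin> A1 \<union> A2"
    then have 1: "(\<Sum>t=1..n. (dual_norm nrm (D (\<xi> t w)))\<^sup>2) \<le> n * s\<^sup>2"
      and 2: "(\<Sum>t=1..n. v (\<Sum>u=1..<t. \<kappa> *\<^sub>R D (\<xi> u w)) \<bullet> D (\<xi> t w)) \<le> lam * sqrt n"
      by (auto simp: A1_def A2_def)
    have "\<kappa> * dual_norm nrm (\<Sum>t=1..n. D (\<xi> t w)) = dual_norm nrm (\<Sum>t=1..n. \<kappa> *\<^sub>R D (\<xi> t w))"
      using \<kappa> by (simp add: dual_norm_scaleR[OF nrm] scaleR_sum_right[symmetric])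
    also have "\<dots> \<le> \<Omega>\<^sup>2 / 2 + (\<Sum>t=1..n. v (\<Sum>u=1..<t. \<kappa> *\<^sub>R D (\<xi> u w)) \<bullet> (\<kappa> *\<^sub>R D (\<xi> t w)))
        + (\<Sum>t=1..n. (dual_norm nrm (\<kappa> *\<^sub>R D (\<xi> t w)))\<^sup>2) / 2"
      by (rule regret)
    also have "\<dots> = \<Omega>\<^sup>2 / 2 + \<kappa> * (\<Sum>t=1..n. v (\<Sum>u=1..<t. \<kappa> *\<^sub>R D (\<xi> u w)) \<bullet> D (\<xi> t w))
        + \<kappa>\<^sup>2 / 2 * (\<Sum>t=1..n. (dual_norm nrm (D (\<xi> t w)))\<^sup>2)"
      using \<kappa> by (simp add: dual_norm_scaleR[OF nrm] sum_distrib_left power_mult_distrib sum_divide_distrib)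
    also have "\<dots> \<le> \<Omega>\<^sup>2 / 2 + \<kappa> * (lam * sqrt n) + \<kappa>\<^sup>2 / 2 * (n * s\<^sup>2)"
      using 1 2 \<kappa> by (intro add_mono mult_left_mono) auto
    also have "\<dots> = \<kappa> * (sqrt n * (\<Omega> / 2 * (1 + s\<^sup>2) + lam))"
    proof -
      have "\<Omega> = \<kappa> * sqrt n" using n by (simp add: \<kappa>_def)
      moreover have "real n = sqrt n * sqrt n" by simp
      ultimately show ?thesis by algebra
    qed
    finally have "dual_norm nrm (\<Sum>t=1..n. D (\<xi> t w)) \<le> sqrt n * (\<Omega> / 2 * (1 + s\<^sup>2) + lam)"
      using \<kappa> by simp
    with w show False by auto
  qed
  then have "prob {w \<in> space M. sqrt n * (\<Omega> / 2 * (1 + s\<^sup>2) + lam) < dual_norm nrm (\<Sum>t=1..n. D (\<xi> t w))}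
      \<le> prob (A1 \<union> A2)"
    using ev1 ev2 by (intro finite_measure_mono) auto
  also have "\<dots> \<le> prob A1 + prob A2" by (rule measure_Un_le[OF ev1 ev2])
  finally show "prob {w \<in> space M. sqrt n * (\<Omega> / 2 * (1 + s\<^sup>2) + lam) < dual_norm nrm (\<Sum>t=1..n. D (\<xi> t w))}
      \<le> exp (- (n * (s\<^sup>2 - 1))) + exp (- (lam\<^sup>2 / (4 * tau_star)))"
    using p1 p2 by linarith
qed

section \<open>Subgradients of convex functions and of their averages\<close>

text \<open>
  Separate the point of the graph over \<^term>\<open>x\<close> from the strict epigraph. The separating functional
  is not vertical, since the epigraph lies over the whole space.
\<close>

lemma subgradient_exists:
  fixes f :: "'a::euclidean_space \<Rightarrow> real"
  assumes f: "convex_on UNIV f"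
  shows "subdifferential f x \<noteq> {}"
proof -
  let ?T = "{p. f (fst p) < snd p}"
  have "convex ?T"
  proof (rule convexI, clarsimp)
    fix y s y' s' and u v :: real
    assume *: "f y < s" "f y' < s'" and uv: "0 \<le> u" "0 \<le> v" "u + v = 1"
    have "f (u *\<^sub>R y + v *\<^sub>R y') \<le> u * f y + v * f y'"
      using f uv by (simp add: convex_on_def)
    also have "\<dots> < u * s + v * s'"
    proof (cases "u = 0")
      case False
      then have "u * f y < u * s" "v * f y' \<le> v * s'" using * uv by (auto intro: mult_left_mono)
      then show ?thesis by linarith
    qed (use * uv in auto)
    finally show "f (u *\<^sub>R y + v *\<^sub>R y') < u * s + v * s'" .
  qed
  moreover have "(x, f x + 1) \<in> ?T" by simp
  then have "?T \<noteq> {}" by blast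
  ultimately have "\<exists>a b. a \<noteq> 0 \<and> (\<forall>p\<in>{(x, f x)}. a \<bullet> p \<le> b) \<and> (\<forall>p\<in>?T. b \<le> a \<bullet> p)"
    by (intro separating_hyperplane_sets) auto
  then obtain a b where a: "a \<noteq> 0" "a \<bullet> (x, f x) \<le> b" "\<forall>p\<in>?T. b \<le> a \<bullet> p" by blast
  obtain u \<alpha> where a_eq: "a = (u, \<alpha>)" by (cases a)
  have ne: "(u, \<alpha>) \<noteq> 0" using a(1) a_eq by simp
  have sep: "u \<bullet> x + \<alpha> * f x \<le> u \<bullet> y + \<alpha> * t" if "f y < t" for y t
    using a(2) bspec[OF a(3), of "(y, t)"] that by (simp add: a_eq)
  have "0 \<le> \<alpha>" using sep[of x "f x + 1"] by (simp add: algebra_simps)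
  moreover have "\<alpha> \<noteq> 0"
  proof
    assume "\<alpha> = 0"
    with sep[of "x - u" "f (x - u) + 1"] have "u \<bullet> u \<le> 0" by (simp add: inner_diff_right)
    then have "u = 0" using inner_ge_zero[of u] by (metis antisym inner_eq_zero_iff)
    with ne \<open>\<alpha> = 0\<close> show False by (metis zero_prod_def)
  qed
  ultimately have pos: "0 < \<alpha>" by simp
  have "f x + (- (1 / \<alpha>) *\<^sub>R u) \<bullet> (y - x) \<le> f y" for y
  proof (rule field_le_epsilon)
    fix e :: real assume "0 < e"
    then have "u \<bullet> x + \<alpha> * f x \<le> u \<bullet> y + \<alpha> * (f y + e)" by (intro sep) simp
    then show "f x + (- (1 / \<alpha>) *\<^sub>R u) \<bullet> (y - x) \<le> f y + e"
      using pos by (simp add: field_simps inner_diff_right)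
  qed
  then show ?thesis unfolding subdifferential_def by blast
qed

text \<open>
  This bound is what makes the supremum in \<^const>\<open>subgrad_deviation\<close> an upper bound for the
  individual deviations.
\<close>

lemma subdifferential_norm_bound:
  fixes f :: "'a::euclidean_space \<Rightarrow> real"
  shows "\<exists>K. \<forall>g\<in>subdifferential f x. norm g \<le> K"
proof (intro exI ballI)
  fix g assume g: "g \<in> subdifferential f x"
  have *: "f x + g \<bullet> d \<le> f (x + d)" for d
    using g[unfolded subdifferential_def] by (auto dest: spec[of _ "x + d"])
  have "norm g \<le> (\<Sum>b\<in>Basis. \<bar>g \<bullet> b\<bar>)" by (rule norm_le_l1)
  also have "\<dots> \<le> (\<Sum>b\<in>Basis. \<bar>f (x + b) - f x\<bar> + \<bar>f (x - b) - f x\<bar>)"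
  proof (rule sum_mono)
    fix b :: 'a
    show "\<bar>g \<bullet> b\<bar> \<le> \<bar>f (x + b) - f x\<bar> + \<bar>f (x - b) - f x\<bar>"
      using *[of b] *[of "- b"] by simp
  qed
  finally show "norm g \<le> (\<Sum>b\<in>Basis. \<bar>f (x + b) - f x\<bar> + \<bar>f (x - b) - f x\<bar>)" .
qed

lemma subgradient_eq_derivative:
  fixes f :: "'a::euclidean_space \<Rightarrow> real"
  assumes f': "(f has_derivative f') (at x)" and g: "g \<in> subdifferential f x"
  shows "f' h = g \<bullet> h"
proof -
  have "((\<lambda>y. f y - g \<bullet> (y - x)) has_derivative (\<lambda>h. f' h - g \<bullet> h)) (at x)"
    by (auto intro!: derivative_eq_intros f')
  moreover have "f x - g \<bullet> (x - x) \<le> f y - g \<bullet> (y - x)" for y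
    using g by (auto simp: subdifferential_def dest: spec[of _ y])
  ultimately have "(\<lambda>h. f' h - g \<bullet> h) = (\<lambda>h. 0)"
    by (intro differential_zero_maxmin[of x UNIV]) auto
  then show ?thesis by (auto dest: fun_cong[of _ _ h])
qed

lemma derivative_nonneg_at_minimum:
  fixes f :: "'a::real_normed_vector \<Rightarrow> real"
  assumes f': "(f has_derivative f') (at x)" and X: "convex X" "x \<in> X" "y \<in> X"
    and min: "\<And>z. z \<in> X \<Longrightarrow> f x \<le> f z"
  shows "0 \<le> f' (y - x)"
proof (rule ccontr)
  assume neg: "\<not> 0 \<le> f' (y - x)"
  have "((\<lambda>t. f (x + t *\<^sub>R (y - x))) has_derivative (\<lambda>t. f' (t *\<^sub>R (y - x)))) (at 0)"
    by (rule has_derivative_compose[of "\<lambda>t. x + t *\<^sub>R (y - x)" "\<lambda>t. t *\<^sub>R (y - x)" 0 UNIV f f'])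
      (use f' in \<open>auto intro!: derivative_eq_intros\<close>)
  moreover have "(\<lambda>t. f' (t *\<^sub>R (y - x))) = (*) (f' (y - x))"
    using has_derivative_linear[OF f'] by (auto simp: linear_scale)
  ultimately have "((\<lambda>t. f (x + t *\<^sub>R (y - x))) has_field_derivative f' (y - x)) (at 0)"
    by (simp add: has_field_derivative_def)
  from DERIV_neg_dec_right[OF this] neg obtain d where d: "0 < d"
    "\<And>h. 0 < h \<Longrightarrow> h < d \<Longrightarrow> f (x + h *\<^sub>R (y - x)) < f x" by auto
  define h where "h = min (d / 2) 1"
  have h: "0 < h" "h < d" "h \<le> 1" using d(1) by (auto simp: h_def)
  have "x + h *\<^sub>R (y - x) \<in> X"
    using convexD_alt[OF X, of h] h by (simp add: algebra_simps)
  with min d(2)[OF h(1,2)] show False by fastforce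
qed

text \<open>
  For a direction \<open>e\<close>, the inner product with any subgradient at \<^term>\<open>x\<close> lies between minus the
  difference quotients of \<open>F\<close> in direction \<open>- e\<close> and those in direction \<open>e\<close>. The gap between the two is
  nonnegative, and its mean tends to zero because the average is differentiable. So almost surely the gap has
  infimum zero, the infimum of the difference quotients is the only possible value, and being a
  countable infimum it is measurable. Integrating the subgradient inequality shows that the mean of the
  subgradient is a subgradient of the average.
\<close>

lemma AE_unique_subgradient:
  fixes F :: "'a::euclidean_space \<Rightarrow> 'b \<Rightarrow> real"
  assumes "prob_space P"
    and convex: "\<And>z. convex_on UNIV (\<lambda>y. F y z)"
    and int: "\<And>y. integrable P (F y)"
    and f: "f = (\<lambda>y. \<integral>z. F y z \<partial>P)"
    and diff: "f differentiable (at x)"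
  shows "\<exists>G. integrable P G \<and> (\<integral>z. G z \<partial>P) \<in> subdifferential f x \<and>
    (AE z in P. subdifferential (\<lambda>y. F y z) x = {G z})"
proof -
  interpret prob_space P by fact
  obtain f' where f': "(f has_derivative f') (at x)" using diff by (auto simp: differentiable_def)
  define q where "q n e z = real (Suc n) * (F (x + (1 / real (Suc n)) *\<^sub>R e) z - F x z)" for n e z
  \<comment> \<open>The gap between the two one-sided bounds.\<close>
  define w where "w n e z = q n e z + q n (- e) z" for n e z
  have int_q: "integrable P (q n e)" for n e unfolding q_def using int by auto
  have int_w: "integrable P (w n e)" for n e unfolding w_def using int_q by auto
  have [measurable]: "q n e \<in> borel_measurable P" "w n e \<in> borel_measurable P" for n e
    using int_q int_w by auto
  have sub_q: "g \<bullet> e \<le> q n e z" if "g \<in> subdifferential (\<lambda>y. F y z) x" for g n e z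
  proof -
    have "F x z + g \<bullet> (x + (1 / real (Suc n)) *\<^sub>R e - x) \<le> F (x + (1 / real (Suc n)) *\<^sub>R e) z"
      using that unfolding subdifferential_def by blast
    then show ?thesis unfolding q_def by (simp add: field_simps)
  qed
  have w_nonneg: "0 \<le> w n e z" for n e z
    using subgradient_exists[OF convex, of z x] sub_q[of _ z e n] sub_q[of _ z "- e" n]
    unfolding w_def by fastforce
  have lim_q: "(\<lambda>n. expectation (q n e)) \<longlonglongrightarrow> f' e" for e
  proof -
    have "((\<lambda>t. f (x + t *\<^sub>R e)) has_derivative (\<lambda>t. f' (t *\<^sub>R e))) (at 0)"
      by (rule has_derivative_compose[of "\<lambda>t. x + t *\<^sub>R e" "\<lambda>t. t *\<^sub>R e" 0 UNIV f f'])
        (use f' in \<open>auto intro!: derivative_eq_intros\<close>)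
    moreover have "(\<lambda>t. f' (t *\<^sub>R e)) = (*) (f' e)"
      using has_derivative_linear[OF f'] by (auto simp: linear_scale)
    ultimately have "((\<lambda>t. f (x + t *\<^sub>R e)) has_field_derivative f' e) (at 0)"
      by (simp add: has_field_derivative_def)
    then have "((\<lambda>h. (f (x + h *\<^sub>R e) - f x) / h) \<longlongrightarrow> f' e) (at 0)"
      by (simp add: DERIV_def)
    moreover have "filterlim (\<lambda>n. 1 / real (Suc n)) (at 0) sequentially"
      unfolding filterlim_at using LIMSEQ_Suc[OF lim_1_over_n] by auto
    ultimately have "(\<lambda>n. (f (x + (1 / real (Suc n)) *\<^sub>R e) - f x) / (1 / real (Suc n))) \<longlonglongrightarrow> f' e"
      by (rule filterlim_compose)
    moreover have "expectation (q n e) = (f (x + (1 / real (Suc n)) *\<^sub>R e) - f x) / (1 / real (Suc n))" for n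
      unfolding q_def f using int by (simp add: field_simps)
    ultimately show ?thesis by simp
  qed
  have "f' (- e) = - f' e" for e
    using has_derivative_linear[OF f'] by (simp add: linear_neg)
  then have lim_w: "(\<lambda>n. expectation (w n e)) \<longlonglongrightarrow> 0" for e
    using tendsto_add[OF lim_q[of e] lim_q[of "- e"]] int_q unfolding w_def by simp
  have inf_w: "AE z in P. (INF n. ennreal (w n e z)) = 0" for e
  proof -
    have "(\<integral>\<^sup>+z. (INF n. ennreal (w n e z)) \<partial>P) \<le> ennreal (expectation (w n e))" for n
    proof -
      have "(\<integral>\<^sup>+z. (INF n. ennreal (w n e z)) \<partial>P) \<le> (\<integral>\<^sup>+z. ennreal (w n e z) \<partial>P)"
        by (intro nn_integral_mono INF_lower) simp
      also have "\<dots> = ennreal (expectation (w n e))"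
        using w_nonneg by (intro nn_integral_eq_integral int_w) auto
      finally show ?thesis .
    qed
    moreover have "(\<lambda>n. ennreal (expectation (w n e))) \<longlonglongrightarrow> ennreal 0"
      by (intro tendsto_ennrealI lim_w)
    ultimately have "(\<integral>\<^sup>+z. (INF n. ennreal (w n e z)) \<partial>P) \<le> ennreal 0"
      by (intro LIMSEQ_le_const) auto
    then show ?thesis by (subst (asm) ennreal_0, subst nn_integral_0_iff_AE[symmetric]) auto
  qed
  define G where "G z = (\<Sum>b\<in>Basis. (INF n. q n b z) *\<^sub>R b)" for z
  have G_meas[measurable]: "G \<in> borel_measurable P" unfolding G_def by measurable
  have "AE z in P. \<forall>b\<in>Basis. (INF n. ennreal (w n b z)) = 0"
    using inf_w by (intro AE_finite_allI) auto
  then have unique: "AE z in P. subdifferential (\<lambda>y. F y z) x = {G z}"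
  proof eventually_elim
    case (elim z)
    have eq: "g = G z" if g: "g \<in> subdifferential (\<lambda>y. F y z) x" for g
    proof (rule euclidean_eqI)
      fix b :: 'a assume b: "b \<in> Basis"
      have bdd: "bdd_below (range (\<lambda>n. q n b z))"
        using sub_q[OF g, of b] by (auto intro!: bdd_belowI[of _ "g \<bullet> b"])
      have "(INF n. q n b z) \<le> g \<bullet> b"
      proof (rule field_le_epsilon)
        fix e :: real assume "0 < e"
        then have "(INF n. ennreal (w n b z)) < ennreal e" using elim b by simp
        then obtain n where "ennreal (w n b z) < ennreal e" by (auto simp: INF_less_iff)
        then have "w n b z < e" using w_nonneg by (simp add: ennreal_less_iff)
        moreover have "- (g \<bullet> b) \<le> q n (- b) z" using sub_q[OF g, of "- b" n] by simp
        ultimately have "q n b z \<le> g \<bullet> b + e" unfolding w_def by simp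
        then show "(INF n. q n b z) \<le> g \<bullet> b + e"
          using cINF_lower[OF bdd, of n] by simp
      qed
      moreover have "g \<bullet> b \<le> (INF n. q n b z)"
        by (intro cINF_greatest sub_q g) simp
      ultimately show "g \<bullet> b = G z \<bullet> b" using b by (simp add: G_def)
    qed
    show ?case using subgradient_exists[OF convex, of z x] eq by blast
  qed
  have int_Gb: "integrable P (\<lambda>z. G z \<bullet> b)" for b
  proof (rule Bochner_Integration.integrable_bound)
    show "integrable P (\<lambda>z. \<bar>q 0 b z\<bar> + \<bar>q 0 (- b) z\<bar>)" using int_q by auto
    show "AE z in P. norm (G z \<bullet> b) \<le> norm (\<bar>q 0 b z\<bar> + \<bar>q 0 (- b) z\<bar>)"
      using unique
    proof eventually_elim
      case (elim z)
      then show ?case using sub_q[of "G z" z b 0] sub_q[of "G z" z "- b" 0] by auto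
    qed
  qed measurable
  have "integrable P (\<lambda>z. \<Sum>b\<in>Basis. (G z \<bullet> b) *\<^sub>R b)"
    using int_Gb by auto
  then have int_G: "integrable P G" by (simp add: euclidean_representation)
  have "(\<integral>z. G z \<partial>P) \<in> subdifferential f x"
    unfolding subdifferential_def
  proof (rule CollectI, rule allI)
    fix y
    have "f x + (\<integral>z. G z \<partial>P) \<bullet> (y - x) = (\<integral>z. F x z + G z \<bullet> (y - x) \<partial>P)"
      unfolding f using int int_G by simp
    also have "\<dots> \<le> (\<integral>z. F y z \<partial>P)"
    proof (rule integral_mono_AE)
      show "AE z in P. F x z + G z \<bullet> (y - x) \<le> F y z"
        using unique by eventually_elim (auto simp: subdifferential_def)
    qed (use int int_G in auto)
    finally show "f x + (\<integral>z. G z \<partial>P) \<bullet> (y - x) \<le> f y" by (simp add: f)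
  qed
  with int_G unique show ?thesis by blast
qed

lemma convex_on_integral:
  fixes F :: "'a::real_vector \<Rightarrow> 'b \<Rightarrow> real"
  assumes "\<And>z. convex_on UNIV (\<lambda>y. F y z)" and int: "\<And>y. integrable P (F y)"
  shows "convex_on UNIV (\<lambda>y. \<integral>z. F y z \<partial>P)"
proof (rule convex_onI)
  fix t :: real and x y assume t: "0 < t" "t < 1"
  have "(\<integral>z. F ((1 - t) *\<^sub>R x + t *\<^sub>R y) z \<partial>P) \<le> (\<integral>z. (1 - t) * F x z + t * F y z \<partial>P)"
    using t by (intro integral_mono int Bochner_Integration.integrable_add integrable_mult_right
      convex_onD[OF assms(1)]) auto
  then show "(\<integral>z. F ((1 - t) *\<^sub>R x + t *\<^sub>R y) z \<partial>P) \<le> (1 - t) * (\<integral>z. F x z \<partial>P) + t * (\<integral>z. F y z \<partial>P)"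
    using int by simp
qed simp

lemma subgrad_deviation_upper:
  fixes f :: "nat \<Rightarrow> 'a::euclidean_space \<Rightarrow> real"
  assumes nrm: "is_norm nrm" and i: "i \<le> m"
    and g: "g \<in> subdifferential (\<lambda>y. F i y z) x" and h: "h \<in> subdifferential (f i) x"
  shows "dual_norm nrm (g - h) \<le> subgrad_deviation nrm m F f x z"
  unfolding subgrad_deviation_def
proof (rule cSup_upper)
  let ?S = "{dual_norm nrm (g - h) | i g h.
            i \<le> m \<and> g \<in> subdifferential (\<lambda>y. F i y z) x \<and> h \<in> subdifferential (f i) x}"
  show "dual_norm nrm (g - h) \<in> ?S" using i g h by blast
  obtain C where C: "0 \<le> C" "\<And>y. dual_norm nrm y \<le> C * norm y"
    using dual_norm_le_norm[OF nrm] by blast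
  have "\<forall>i. \<exists>K. \<forall>g\<in>subdifferential (\<lambda>y. F i y z) x. norm g \<le> K"
    using subdifferential_norm_bound by blast
  then obtain K where K: "\<And>i g. g \<in> subdifferential (\<lambda>y. F i y z) x \<Longrightarrow> norm g \<le> K i" by metis
  have "\<forall>i. \<exists>K. \<forall>g\<in>subdifferential (f i) x. norm g \<le> K"
    using subdifferential_norm_bound by blast
  then obtain K' where K': "\<And>i h. h \<in> subdifferential (f i) x \<Longrightarrow> norm h \<le> K' i" by metis
  show "bdd_above ?S"
  proof (rule bdd_aboveI)
    fix a assume "a \<in> ?S"
    then obtain i g h where a: "a = dual_norm nrm (g - h)" and i: "i \<le> m"
      and g: "g \<in> subdifferential (\<lambda>y. F i y z) x" and h: "h \<in> subdifferential (f i) x" by blast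
    have "a \<le> C * norm (g - h)" unfolding a by (rule C)
    also have "norm (g - h) \<le> \<bar>K i\<bar> + \<bar>K' i\<bar>"
      using norm_triangle_ineq4[of g h] K[OF g] K'[OF h] by linarith
    also have "\<dots> \<le> (\<Sum>j\<le>m. \<bar>K j\<bar> + \<bar>K' j\<bar>)"
      using i by (intro member_le_sum) auto
    finally show "a \<le> C * (\<Sum>j\<le>m. \<bar>K j\<bar> + \<bar>K' j\<bar>)" using C(1) by (simp add: mult_left_mono)
  qed
qed

section \<open>Multipliers for a system of convex inequalities\<close>

text \<open>
  Both the open quadrant of values below \<^term>\<open>c\<close> and the set of pairs that dominate some pair of values
  are convex, and by assumption they are disjoint. The normal of a separating line, normalized to
  coordinate sum one, is the pair of weights.
\<close>

lemma convex_pair_multiplier: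
  fixes \<phi> \<psi> :: "'a::real_vector \<Rightarrow> real"
  assumes X: "X \<noteq> {}" "convex X" and \<phi>: "convex_on X \<phi>" and \<psi>: "convex_on X \<psi>"
    and c: "\<And>x. x \<in> X \<Longrightarrow> c \<le> \<phi> x \<or> c \<le> \<psi> x"
  shows "\<exists>l\<in>{0..1}. \<forall>x\<in>X. c \<le> (1 - l) * \<phi> x + l * \<psi> x"
proof -
  let ?S = "{p. fst p < c \<and> snd p < c}" and ?T = "{p. \<exists>x\<in>X. \<phi> x \<le> fst p \<and> \<psi> x \<le> snd p}"
  have "?S = {..<c} \<times> {..<c}" by auto
  then have "convex ?S" by (simp add: convex_Times)
  moreover have "convex ?T"
  proof (rule convexI, clarsimp)
    fix a b a' b' x y and u v :: real
    assume xy: "x \<in> X" "y \<in> X" and *: "\<phi> x \<le> a" "\<psi> x \<le> b" "\<phi> y \<le> a'" "\<psi> y \<le> b'"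
      and uv: "0 \<le> u" "0 \<le> v" "u + v = 1"
    have "u * \<phi> x + v * \<phi> y \<le> u * a + v * a'" "u * \<psi> x + v * \<psi> y \<le> u * b + v * b'"
      using * uv by (auto intro!: add_mono mult_left_mono)
    moreover have "\<phi> (u *\<^sub>R x + v *\<^sub>R y) \<le> u * \<phi> x + v * \<phi> y" "\<psi> (u *\<^sub>R x + v *\<^sub>R y) \<le> u * \<psi> x + v * \<psi> y"
      using \<phi> \<psi> xy uv by (auto simp: convex_on_def)
    moreover have "u *\<^sub>R x + v *\<^sub>R y \<in> X" using X(2) xy uv by (simp add: convex_def)
    ultimately show "\<exists>w\<in>X. \<phi> w \<le> u * a + v * a' \<and> \<psi> w \<le> u * b + v * b'"
      by (meson order_trans)
  qed
  moreover have "(c - 1, c - 1) \<in> ?S" by simp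
  moreover obtain x0 where x0: "x0 \<in> X" using X(1) by blast
  then have "(\<phi> x0, \<psi> x0) \<in> ?T" by auto
  moreover have "?S \<inter> ?T = {}" using c by fastforce
  ultimately have "\<exists>a b. a \<noteq> 0 \<and> (\<forall>p\<in>?S. a \<bullet> p \<le> b) \<and> (\<forall>p\<in>?T. b \<le> a \<bullet> p)"
    by (intro separating_hyperplane_sets) blast+
  then obtain a b where a: "a \<noteq> 0" "\<forall>r\<in>?S. a \<bullet> r \<le> b" "\<forall>r\<in>?T. b \<le> a \<bullet> r" by blast
  obtain p q where a_eq: "a = (p, q)" by (cases a)
  have ne: "(p, q) \<noteq> 0" using a(1) a_eq by simp
  have S': "p * r + q * s \<le> b" if "r < c" "s < c" for r s
    using bspec[OF a(2), of "(r, s)"] that by (simp add: a_eq)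
  have T': "b \<le> p * r + q * s" if "x \<in> X" "\<phi> x \<le> r" "\<psi> x \<le> s" for r s x
    using bspec[OF a(3), of "(r, s)"] that by (auto simp: a_eq)
  \<comment> \<open>The second set is closed under increasing either coordinate, so the normal is nonnegative.\<close>
  have nonneg: "0 \<le> r" if growth: "\<And>t. 0 \<le> t \<Longrightarrow> b \<le> d + r * t" for r d :: real
  proof (rule ccontr)
    assume "\<not> 0 \<le> r"
    then obtain t where "0 \<le> t" "r * t = - (\<bar>d - b\<bar> + 1)"
      by (intro that[of "(\<bar>d - b\<bar> + 1) / - r"]) (auto intro: divide_nonneg_neg)
    with growth[of t] show False by linarith
  qed
  have "0 \<le> p" using T'[OF x0, of "\<phi> x0 + t" "\<psi> x0" for t]
    by (intro nonneg[of "p * \<phi> x0 + q * \<psi> x0"]) (auto simp: algebra_simps)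
  moreover have "0 \<le> q" using T'[OF x0, of "\<phi> x0" "\<psi> x0 + t" for t]
    by (intro nonneg[of "p * \<phi> x0 + q * \<psi> x0"]) (auto simp: algebra_simps)
  moreover have "p \<noteq> 0 \<or> q \<noteq> 0" using ne by (metis zero_prod_def)
  ultimately have pos: "0 < p + q" "0 \<le> p" "0 \<le> q" by auto
  have "(p + q) * c \<le> b"
  proof (rule field_le_epsilon)
    fix e :: real assume e: "0 < e"
    then have "p * (c - e / (p + q)) + q * (c - e / (p + q)) \<le> b" using pos by (intro S') auto
    moreover have "p * (c - e / (p + q)) + q * (c - e / (p + q)) = (p + q) * c - e"
      unfolding distrib_right[symmetric] using pos by (simp add: right_diff_distrib)
    ultimately show "(p + q) * c \<le> b + e" by linarith
  qed
  then have "(p + q) * c \<le> p * \<phi> x + q * \<psi> x" if "x \<in> X" for x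
    using T'[OF that order_refl order_refl] by linarith
  then have "c \<le> (p * \<phi> x + q * \<psi> x) / (p + q)" if "x \<in> X" for x
    using that pos by (simp add: pos_le_divide_eq mult.commute)
  moreover have "1 - q / (p + q) = p / (p + q)" using pos by (simp add: field_simps)
  ultimately have "c \<le> (1 - q / (p + q)) * \<phi> x + q / (p + q) * \<psi> x" if "x \<in> X" for x
    using that by (simp add: add_divide_distrib)
  moreover have "q / (p + q) \<in> {0..1}" using pos by simp
  ultimately show ?thesis by blast
qed

text \<open>
  The pair of the maximum of all but the last function and the last function has a multiplier.
  At each point the maximum is one of its members, so the functions mixed with the last one satisfy
  the hypothesis again, with one function less.
\<close>

lemma convex_multipliers:
  fixes \<phi> :: "nat \<Rightarrow> 'a::real_vector \<Rightarrow> real"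
  assumes X: "X \<noteq> {}" "convex X" and \<phi>: "\<And>i. i \<le> m \<Longrightarrow> convex_on X (\<phi> i)"
    and c: "\<And>x. x \<in> X \<Longrightarrow> \<exists>i\<le>m. c \<le> \<phi> i x"
  shows "\<exists>l. (\<forall>i\<le>m. 0 \<le> l i) \<and> (\<Sum>i\<le>m. l i) = 1 \<and> (\<forall>x\<in>X. c \<le> (\<Sum>i\<le>m. l i * \<phi> i x))"
  using \<phi> c
proof (induction m arbitrary: \<phi>)
  case 0
  then show ?case by (intro exI[of _ "\<lambda>_. 1"]) auto
next
  case (Suc m)
  define \<psi> where "\<psi> x = Max ((\<lambda>i. \<phi> i x) ` {..m})" for x
  have ge: "\<phi> i x \<le> \<psi> x" if "i \<le> m" for i x unfolding \<psi>_def using that by simp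
  have attained: "\<exists>i\<le>m. \<psi> x = \<phi> i x" for x
  proof -
    have "\<psi> x \<in> (\<lambda>i. \<phi> i x) ` {..m}" unfolding \<psi>_def by (intro Max_in) auto
    then show ?thesis by auto
  qed
  have "convex_on X \<psi>"
  proof (rule convex_onI)
    fix t :: real and x y assume t: "0 < t" "t < 1" and xy: "x \<in> X" "y \<in> X"
    obtain i where i: "i \<le> m" "\<psi> ((1 - t) *\<^sub>R x + t *\<^sub>R y) = \<phi> i ((1 - t) *\<^sub>R x + t *\<^sub>R y)"
      using attained by blast
    note i(2)
    also have "\<phi> i ((1 - t) *\<^sub>R x + t *\<^sub>R y) \<le> (1 - t) * \<phi> i x + t * \<phi> i y"
      using Suc.prems(1)[of i] i t xy by (intro convex_onD) auto
    also have "\<dots> \<le> (1 - t) * \<psi> x + t * \<psi> y"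
      using i t by (intro add_mono mult_left_mono ge) auto
    finally show "\<psi> ((1 - t) *\<^sub>R x + t *\<^sub>R y) \<le> (1 - t) * \<psi> x + t * \<psi> y" .
  qed (fact X)
  moreover have "c \<le> \<psi> x \<or> c \<le> \<phi> (Suc m) x" if "x \<in> X" for x
    using Suc.prems(2)[OF that] ge by (fastforce simp: le_Suc_eq intro: order_trans)
  ultimately have "\<exists>k\<in>{0..1}. \<forall>x\<in>X. c \<le> (1 - k) * \<psi> x + k * \<phi> (Suc m) x"
    by (intro convex_pair_multiplier X Suc.prems(1)) auto
  then obtain k where k: "0 \<le> k" "k \<le> 1"
    and kc: "\<And>x. x \<in> X \<Longrightarrow> c \<le> (1 - k) * \<psi> x + k * \<phi> (Suc m) x" by auto
  have "\<exists>l. (\<forall>i\<le>m. 0 \<le> l i) \<and> (\<Sum>i\<le>m. l i) = 1 \<and>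
      (\<forall>x\<in>X. c \<le> (\<Sum>i\<le>m. l i * ((1 - k) * \<phi> i x + k * \<phi> (Suc m) x)))"
  proof (rule Suc.IH)
    show "convex_on X (\<lambda>x. (1 - k) * \<phi> i x + k * \<phi> (Suc m) x)" if "i \<le> m" for i
      using that k Suc.prems(1) by (intro convex_on_add convex_on_cmul) auto
    show "\<exists>i\<le>m. c \<le> (1 - k) * \<phi> i x + k * \<phi> (Suc m) x" if "x \<in> X" for x
      using attained[of x] kc[OF that] by metis
  qed
  then obtain l where l: "\<And>i. i \<le> m \<Longrightarrow> 0 \<le> l i" "(\<Sum>i\<le>m. l i) = 1"
    and lc: "\<And>x. x \<in> X \<Longrightarrow> c \<le> (\<Sum>i\<le>m. l i * ((1 - k) * \<phi> i x + k * \<phi> (Suc m) x))" by blast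
  define l' where "l' i = (if i = Suc m then k else (1 - k) * l i)" for i
  have "(\<Sum>i\<le>Suc m. l' i * \<phi> i x) = (\<Sum>i\<le>m. l i * ((1 - k) * \<phi> i x + k * \<phi> (Suc m) x))" for x
  proof -
    have "(\<Sum>i\<le>m. l i * ((1 - k) * \<phi> i x + k * \<phi> (Suc m) x))
        = (\<Sum>i\<le>m. (1 - k) * l i * \<phi> i x) + (\<Sum>i\<le>m. l i) * (k * \<phi> (Suc m) x)"
      unfolding sum_distrib_right sum.distrib[symmetric]
      by (intro sum.cong) (auto simp: algebra_simps)
    then show ?thesis by (simp add: l'_def l(2))
  qed
  moreover have "(\<Sum>i\<le>Suc m. l' i) = 1"
    using l(2) by (simp add: l'_def sum_distrib_left[symmetric])
  moreover have "\<forall>i\<le>Suc m. 0 \<le> l' i" using k l(1) by (auto simp: l'_def le_Suc_eq)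
  ultimately show ?case using lc by (intro exI[of _ l']) auto
qed

section \<open>Dependence of the optimal value and of the residual on the data\<close>

text \<open>
  A monotone function on the reals is Borel, which is how the residual at the random optimal value
  becomes a random variable.
\<close>

lemma Phi_antimono:
  assumes X: "X \<noteq> {}" "compact X" and f: "continuous_on X (f 0)"
  shows "antimono (Phi X m f)"
proof (rule antimonoI)
  fix r r' :: real assume r: "r \<le> r'"
  obtain x0 where x0: "\<And>x. x \<in> X \<Longrightarrow> f 0 x0 \<le> f 0 x"
    using continuous_attains_inf[OF X(2,1) f] by blast
  let ?M = "\<lambda>r x. Max (insert (f 0 x - r) ((\<lambda>i. f i x) ` {1..m}))"
  have "bdd_below (?M r' ` X)"
  proof (rule bdd_belowI2)
    fix x assume "x \<in> X"
    then have "f 0 x0 - r' \<le> f 0 x - r'" using x0 by simp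
    also have "\<dots> \<le> ?M r' x" by (rule Max_ge) auto
    finally show "f 0 x0 - r' \<le> ?M r' x" .
  qed
  moreover have "?M r' x \<le> ?M r x" for x
  proof (rule Max.boundedI)
    fix a assume "a \<in> insert (f 0 x - r') ((\<lambda>i. f i x) ` {1..m})"
    then consider "a = f 0 x - r'" | "a \<in> (\<lambda>i. f i x) ` {1..m}" by blast
    then show "a \<le> ?M r x"
    proof cases
      case 1
      then have "a \<le> f 0 x - r" using r by simp
      also have "\<dots> \<le> ?M r x" by (rule Max_ge) auto
      finally show ?thesis .
    qed (auto intro!: Max_ge)
  qed auto
  ultimately show "Phi X m f r' \<le> Phi X m f r"
    unfolding Phi_def by (intro cINF_mono X) blast+
qed

lemma Phi_le:
  assumes X: "compact X" and f: "continuous_on X (f 0)"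
    and x: "x \<in> X" "f 0 x - r \<le> e" "\<And>i. i \<in> {1..m} \<Longrightarrow> f i x \<le> e"
  shows "Phi X m f r \<le> e"
proof -
  let ?M = "\<lambda>x. Max (insert (f 0 x - r) ((\<lambda>i. f i x) ` {1..m}))"
  obtain x0 where x0: "\<And>x. x \<in> X \<Longrightarrow> f 0 x0 \<le> f 0 x"
    using continuous_attains_inf[OF X _ f] x(1) by blast
  have "bdd_below (?M ` X)"
  proof (rule bdd_belowI2)
    fix x assume "x \<in> X"
    then have "f 0 x0 - r \<le> f 0 x - r" using x0 by simp
    also have "\<dots> \<le> ?M x" by (rule Max_ge) auto
    finally show "f 0 x0 - r \<le> ?M x" .
  qed
  then have "Phi X m f r \<le> ?M x" unfolding Phi_def using x(1) by (rule cINF_lower)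
  also have "\<dots> \<le> e" using x by (intro Max.boundedI) auto
  finally show ?thesis .
qed

lemma compact_countable_dense:
  fixes X :: "'a::metric_space set"
  assumes "compact X"
  shows "\<exists>D. countable D \<and> D \<subseteq> X \<and> X \<subseteq> closure D"
proof -
  have "\<exists>K. finite K \<and> K \<subseteq> X \<and> X \<subseteq> (\<Union>x\<in>K. ball x (1 / real (Suc n)))" for n
  proof -
    obtain K where "K \<subseteq> X" "finite K" "X \<subseteq> (\<Union>x\<in>K. ball x (1 / real (Suc n)))"
      by (rule compactE_image[OF assms, of X "\<lambda>x. ball x (1 / real (Suc n))"]) auto
    then show ?thesis by blast
  qed
  then obtain K where K: "\<And>n. finite (K n)" "\<And>n. K n \<subseteq> X"
    "\<And>n. X \<subseteq> (\<Union>x\<in>K n. ball x (1 / real (Suc n)))" by metis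
  have "x \<in> closure (\<Union>n. K n)" if x: "x \<in> X" for x
    unfolding closure_approachable
  proof (intro allI impI)
    fix e :: real assume "0 < e"
    then obtain n where n: "1 / real (Suc n) < e" using nat_approx_posE by blast
    obtain y where "y \<in> K n" "dist y x < 1 / real (Suc n)" using K(3)[of n] x by auto
    with n show "\<exists>y\<in>\<Union>n. K n. dist y x < e" by (auto intro: less_trans)
  qed
  then show ?thesis
    using K(1,2) by (intro exI[of _ "\<Union>n. K n"]) (auto intro: countable_finite)
qed

text \<open>
  Over an uncountable set the existence of a feasible point with small objective is not obviously a
  measurable condition. Relaxing the inequalities allows a countable dense set of candidates, and
  compactness recovers an exact solution from approximate ones.
\<close>

lemma compact_sublevel_iff_dense:
  fixes h :: "nat \<Rightarrow> 'a::metric_space \<Rightarrow> real"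
  assumes X: "compact X" and D: "D \<subseteq> X" "X \<subseteq> closure D"
    and h: "\<And>i. i \<le> m \<Longrightarrow> continuous_on X (h i)"
  shows "(\<exists>x\<in>X. h 0 x \<le> c \<and> (\<forall>i\<in>{1..m}. h i x \<le> 0)) \<longleftrightarrow>
    (\<forall>n. \<exists>x\<in>D. h 0 x < c + 1 / real (Suc n) \<and> (\<forall>i\<in>{1..m}. h i x < 1 / real (Suc n)))"
proof
  assume "\<exists>x\<in>X. h 0 x \<le> c \<and> (\<forall>i\<in>{1..m}. h i x \<le> 0)"
  then obtain x where x: "x \<in> X" "h 0 x \<le> c" "\<And>i. i \<in> {1..m} \<Longrightarrow> h i x \<le> 0" by blast
  then obtain d where d: "\<And>k. d k \<in> D" "d \<longlonglongrightarrow> x"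
    using D(2) closure_sequential[of x D] by blast
  have lim: "(\<lambda>k. h i (d k)) \<longlonglongrightarrow> h i x" if "i \<le> m" for i
    by (intro continuous_on_tendsto_compose[OF h[OF that] d(2) x(1)] always_eventually)
      (use d(1) D(1) in auto)
  show "\<forall>n. \<exists>x\<in>D. h 0 x < c + 1 / real (Suc n) \<and> (\<forall>i\<in>{1..m}. h i x < 1 / real (Suc n))"
  proof
    fix n
    have "0 < 1 / real (Suc n)" by simp
    then have "\<forall>\<^sub>F k in sequentially. h 0 (d k) < c + 1 / real (Suc n)"
      using x(2) by (intro order_tendstoD(2)[OF lim]) linarith+
    moreover have "\<forall>\<^sub>F k in sequentially. \<forall>i\<in>{1..m}. h i (d k) < 1 / real (Suc n)"
    proof (intro eventually_ball_finite ballI)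
      fix i assume i: "i \<in> {1..m}"
      then have "h i x < 1 / real (Suc n)"
        using x(3)[OF i] \<open>0 < 1 / real (Suc n)\<close> by linarith
      with i show "\<forall>\<^sub>F k in sequentially. h i (d k) < 1 / real (Suc n)"
        by (intro order_tendstoD(2)[OF lim]) auto
    qed simp
    ultimately have "\<forall>\<^sub>F k in sequentially. h 0 (d k) < c + 1 / real (Suc n) \<and>
        (\<forall>i\<in>{1..m}. h i (d k) < 1 / real (Suc n))" by eventually_elim simp
    then obtain k where "h 0 (d k) < c + 1 / real (Suc n) \<and> (\<forall>i\<in>{1..m}. h i (d k) < 1 / real (Suc n))"
      by (auto simp: eventually_sequentially)
    with d(1) show "\<exists>x\<in>D. h 0 x < c + 1 / real (Suc n) \<and> (\<forall>i\<in>{1..m}. h i x < 1 / real (Suc n))"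
      by blast
  qed
next
  assume "\<forall>n. \<exists>x\<in>D. h 0 x < c + 1 / real (Suc n) \<and> (\<forall>i\<in>{1..m}. h i x < 1 / real (Suc n))"
  then obtain d where d: "\<And>n. d n \<in> D" "\<And>n. h 0 (d n) < c + 1 / real (Suc n)"
    "\<And>n i. i \<in> {1..m} \<Longrightarrow> h i (d n) < 1 / real (Suc n)" by metis
  then have "\<forall>n. d n \<in> X" using D(1) by blast
  then obtain x r where x: "x \<in> X" "strict_mono r" "(d \<circ> r) \<longlonglongrightarrow> x"
    using X[unfolded compact_def] by metis
  have lim: "(\<lambda>k. h i (d (r k))) \<longlonglongrightarrow> h i x" if "i \<le> m" for i
    by (intro continuous_on_tendsto_compose[OF h[OF that] x(3)[unfolded o_def] x(1)] always_eventually)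
      (use d(1) D(1) in auto)
  have "(\<lambda>n. 1 / real (Suc n)) \<longlonglongrightarrow> 0" by (rule LIMSEQ_Suc[OF lim_1_over_n])
  then have inv: "(\<lambda>k. 1 / real (Suc (r k))) \<longlonglongrightarrow> 0"
    using LIMSEQ_subseq_LIMSEQ[OF _ x(2)] by (fastforce simp: o_def)
  have "h 0 x \<le> c + 0"
    using d(2) by (intro LIMSEQ_le[OF lim tendsto_add[OF tendsto_const inv]]) (auto intro: less_imp_le)
  moreover have "h i x \<le> 0" if i: "i \<in> {1..m}" for i
  proof (rule LIMSEQ_le[OF lim inv])
    show "\<exists>N. \<forall>k\<ge>N. h i (d (r k)) \<le> 1 / real (Suc (r k))"
      using d(3)[OF i] less_imp_le by blast
  qed (use i in simp)
  ultimately show "\<exists>x\<in>X. h 0 x \<le> c \<and> (\<forall>i\<in>{1..m}. h i x \<le> 0)" using x(1) by auto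
qed

lemma borel_measurable_opt_value:
  fixes h :: "'w \<Rightarrow> nat \<Rightarrow> 'a::metric_space \<Rightarrow> real"
  assumes X: "compact X"
    and cont: "\<And>w i. w \<in> space M \<Longrightarrow> i \<le> m \<Longrightarrow> continuous_on X (h w i)"
    and meas: "\<And>x i. x \<in> X \<Longrightarrow> i \<le> m \<Longrightarrow> (\<lambda>w. h w i x) \<in> borel_measurable M"
  shows "(\<lambda>w. opt_value X m (h w)) \<in> borel_measurable M"
proof -
  obtain D where D: "countable D" "D \<subseteq> X" "X \<subseteq> closure D"
    using compact_countable_dense[OF X] by blast
  define E where "E c = {w \<in> space M. \<forall>n. \<exists>x\<in>D.
      h w 0 x < c + 1 / real (Suc n) \<and> (\<forall>i\<in>{1..m}. h w i x < 1 / real (Suc n))}" for c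
  have [measurable]: "(\<lambda>w. h w i x) \<in> borel_measurable M" if "x \<in> D" "i \<le> m" for x i
    using meas that D(2) by blast
  have E: "E c \<in> sets M" for c
    unfolding E_def using D(1) by measurable
  have "(\<lambda>w. opt_value X m (h w)) -` {..<a} \<inter> space M = (\<Union>c\<in>{c::rat. ereal (real_of_rat c) < a}. E (real_of_rat c))"
    for a
  proof (intro equalityI subsetI)
    fix w assume w: "w \<in> (\<lambda>w. opt_value X m (h w)) -` {..<a} \<inter> space M"
    then obtain x where x: "x \<in> X" "\<forall>i\<in>{1..m}. h w i x \<le> 0" "ereal (h w 0 x) < a"
      by (auto simp: opt_value_def INF_less_iff)
    obtain c :: rat where c: "ereal (h w 0 x) < real_of_rat c" "ereal (real_of_rat c) < a"
      using ereal_dense3[OF x(3)] by blast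
    then have "w \<in> E (real_of_rat c)"
      unfolding E_def using w x compact_sublevel_iff_dense[where h = "h w" and m = m and c = "real_of_rat c", OF X D(2,3) cont]
      by (auto intro: less_imp_le)
    with c show "w \<in> (\<Union>c\<in>{c::rat. ereal (real_of_rat c) < a}. E (real_of_rat c))" by blast
  next
    fix w assume "w \<in> (\<Union>c\<in>{c::rat. ereal (real_of_rat c) < a}. E (real_of_rat c))"
    then obtain c :: rat where c: "ereal (real_of_rat c) < a" "w \<in> E (real_of_rat c)" by blast
    then have w: "w \<in> space M" by (simp add: E_def)
    obtain x where "x \<in> X" "h w 0 x \<le> real_of_rat c" "\<forall>i\<in>{1..m}. h w i x \<le> 0"
      using c(2) w compact_sublevel_iff_dense[where h = "h w" and m = m and c = "real_of_rat c", OF X D(2,3) cont]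
      unfolding E_def by blast
    then have "opt_value X m (h w) \<le> ereal (real_of_rat c)"
      unfolding opt_value_def by (intro INF_lower2[of x]) auto
    with c(1) w show "w \<in> (\<lambda>w. opt_value X m (h w)) -` {..<a} \<inter> space M" by auto
  qed
  moreover have "(\<Union>c\<in>{c::rat. ereal (real_of_rat c) < a}. E (real_of_rat c)) \<in> sets M" for a
    using E by (intro sets.countable_UN') (auto intro: countableI_type)
  ultimately show ?thesis unfolding borel_measurable_ereal_iff_Iio by simp
qed

lemma opt_value_attained:
  fixes f :: "nat \<Rightarrow> 'a::metric_space \<Rightarrow> real"
  assumes X: "compact X" and f: "\<And>i. i \<le> m \<Longrightarrow> continuous_on X (f i)"
    and feasible: "\<exists>x\<in>X. \<forall>i\<in>{1..m}. f i x \<le> e"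
  shows "\<exists>x\<in>X. (\<forall>i\<in>{1..m}. f i x \<le> e) \<and> (\<forall>y\<in>X. (\<forall>i\<in>{1..m}. f i y \<le> e) \<longrightarrow> f 0 x \<le> f 0 y)"
proof -
  let ?S = "X \<inter> (\<Inter>i\<in>{1..m}. {x \<in> X. f i x \<le> e})"
  have "closed {x \<in> X. f i x \<le> e}" if "i \<in> {1..m}" for i
    using continuous_on_closed_Collect_le[OF f continuous_on_const compact_imp_closed[OF X], of i e] that
    by auto
  then have "compact ?S" by (intro compact_Int_closed[OF X] closed_INT) auto
  moreover have "?S \<noteq> {}" using feasible by blast
  moreover have "continuous_on ?S (f 0)" using f[of 0] by (auto intro: continuous_on_subset)
  ultimately have "\<exists>x\<in>?S. \<forall>y\<in>?S. f 0 x \<le> f 0 y" by (rule continuous_attains_inf)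
  then show ?thesis by auto
qed

lemma opt_value_eq:
  assumes "x \<in> X" "\<forall>i\<in>{1..m}. f i x \<le> 0"
    and "\<forall>y\<in>X. (\<forall>i\<in>{1..m}. f i y \<le> 0) \<longrightarrow> f 0 x \<le> f 0 y"
  shows "opt_value X m f = ereal (f 0 x)"
proof (rule antisym)
  show "opt_value X m f \<le> ereal (f 0 x)"
    unfolding opt_value_def using assms(1,2) by (intro INF_lower) auto
  show "ereal (f 0 x) \<le> opt_value X m f"
    unfolding opt_value_def using assms(3) by (intro INF_greatest) auto
qed

lemma borel_measurable_opt_value_underestimates:
  fixes h :: "'w \<Rightarrow> nat \<Rightarrow> 'e::metric_space \<Rightarrow> real"
  assumes X: "X \<noteq> {}" "compact X" and f: "continuous_on X (f 0)"
    and cont: "\<And>w i. i \<le> m \<Longrightarrow> continuous_on X (h w i)"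
    and meas: "\<And>x i. i \<le> m \<Longrightarrow> (\<lambda>w. h w i x) \<in> borel_measurable M"
  shows "{w \<in> space M. \<exists>\<rho>. opt_value X m (h w) = ereal \<rho> \<and> underestimates e X m f \<rho>} \<in> sets M"
proof -
  have [measurable]: "(\<lambda>w. opt_value X m (h w)) \<in> borel_measurable M"
    by (rule borel_measurable_opt_value[OF X(2) cont meas])
  have "mono (\<lambda>r. - Phi X m f r)"
    using Phi_antimono[where f = f and m = m, OF X f] by (auto simp: mono_def antimono_def)
  then have "(\<lambda>r. - (- Phi X m f r)) \<in> borel_measurable borel"
    by (intro borel_measurable_uminus borel_measurable_mono)
  then have [measurable]: "Phi X m f \<in> borel_measurable borel" by simp
  have "{w \<in> space M. \<exists>\<rho>. opt_value X m (h w) = ereal \<rho> \<and> underestimates e X m f \<rho>}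
      = {w \<in> space M. \<bar>opt_value X m (h w)\<bar> \<noteq> \<infinity> \<and> opt_value X m (h w) \<le> opt_value X m f \<and>
          Phi X m f (real_of_ereal (opt_value X m (h w))) \<le> e}"
  proof (intro Collect_cong conj_cong refl)
    fix w
    show "(\<exists>\<rho>. opt_value X m (h w) = ereal \<rho> \<and> underestimates e X m f \<rho>) \<longleftrightarrow>
      \<bar>opt_value X m (h w)\<bar> \<noteq> \<infinity> \<and> opt_value X m (h w) \<le> opt_value X m f \<and>
          Phi X m f (real_of_ereal (opt_value X m (h w))) \<le> e"
      unfolding underestimates_def by (cases "opt_value X m (h w)") auto
  qed
  also have "\<dots> \<in> sets M" by measurable
  finally show ?thesis .
qed

section \<open>The confidence bound\<close>

text \<open>
  The square and the exponential are both convex. In expectation, a convex combination of random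
  variables with the same bound on the exponential of the square therefore inherits that bound.
\<close>

lemma exp_square_convex_combination:
  fixes l y :: "'i \<Rightarrow> real"
  assumes I: "finite I" and l: "\<And>i. i \<in> I \<Longrightarrow> 0 \<le> l i" "(\<Sum>i\<in>I. l i) = 1"
  shows "exp ((\<Sum>i\<in>I. l i * y i)\<^sup>2) \<le> (\<Sum>i\<in>I. l i * exp ((y i)\<^sup>2))"
proof -
  have ne: "I \<noteq> {}" using l(2) by auto
  have "(\<Sum>i\<in>I. l i *\<^sub>R y i)\<^sup>2 \<le> (\<Sum>i\<in>I. l i * (y i)\<^sup>2)"
    using I ne l by (intro convex_on_sum[where C = UNIV] convex_power2) auto
  then have "exp ((\<Sum>i\<in>I. l i * y i)\<^sup>2) \<le> exp (\<Sum>i\<in>I. l i *\<^sub>R (y i)\<^sup>2)" by simp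
  also have "\<dots> \<le> (\<Sum>i\<in>I. l i * exp ((y i)\<^sup>2))"
    using I ne l by (intro convex_on_sum[OF _ _ exp_convex]) auto
  finally show ?thesis .
qed

text \<open>
  The bound for integrands that are convex for every sample point. With \<^term>\<open>r\<close> the least value of
  \<^term>\<open>f 0\<close> under the constraints relaxed to \<^term>\<open>\<epsilon>\<close>, minus \<^term>\<open>\<epsilon>\<close>, it is enough that
  the sampled optimal value lies between \<^term>\<open>r\<close> and the true one. The exceptional events are those
  at the true optimum (\<^term>\<open>m + 1\<close> of them), the one for the value of the combination at its minimizer \<open>c\<close>,
  and the one for its gradient there.
\<close>

lemma (in prob_space) probability_underestimates:
  fixes nrm :: "'e::euclidean_space \<Rightarrow> real"
    and \<xi> :: "nat \<Rightarrow> 'a \<Rightarrow> 'b::topological_space"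
    and F :: "nat \<Rightarrow> 'e \<Rightarrow> 'b \<Rightarrow> real"
    and s :: real
  assumes nrm: "is_norm nrm" and C1: "C1_on_ball_with_gradient nrm \<omega> grad\<omega>"
    and strong: "\<And>x y. x \<in> unit_ball nrm \<Longrightarrow> y \<in> unit_ball nrm \<Longrightarrow>
           (grad\<omega> x - grad\<omega> y) \<bullet> (x - y) \<ge> (nrm (x - y))\<^sup>2"
    and \<omega>0: "\<omega> 0 = 0" "grad\<omega> 0 = 0" and \<Omega>: "\<Omega> = (SUP x\<in>unit_ball nrm. sqrt (2 * \<omega> x))"
    and X: "X \<noteq> {}" "convex X" "compact X"
    and R: "R = covering_radius nrm X"
    and indep: "indep_vars (\<lambda>_. borel) \<xi> {1..}" and law: "\<And>t. t \<ge> 1 \<Longrightarrow> distr M borel (\<xi> t) = P"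
    and P: "prob_space P" "sets P = sets borel"
    and convex: "\<And>i z. i \<le> m \<Longrightarrow> convex_on UNIV (\<lambda>x. F i x z)"
    and int: "\<And>i x. i \<le> m \<Longrightarrow> integrable P (F i x)"
    and f: "f = (\<lambda>i x. \<integral>z. F i x z \<partial>P)"
    and diff: "\<And>i x. i \<le> m \<Longrightarrow> x \<in> X \<Longrightarrow> f i differentiable (at x)"
    and M: "M1 > 0" "M2 > 0"
    and light1: "\<And>i x. i \<le> m \<Longrightarrow> x \<in> X \<Longrightarrow>
           (\<integral>\<^sup>+z. ennreal (exp ((F i x z - f i x)\<^sup>2 / M1\<^sup>2)) \<partial>P) \<le> ennreal (exp 1)"
    and light2: "\<And>x. x \<in> X \<Longrightarrow>
           (\<integral>\<^sup>+z. ennreal (exp ((subgrad_deviation nrm m F f x z)\<^sup>2 / M2\<^sup>2)) \<partial>P) \<le> ennreal (exp 1)"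
    and feasible: "\<exists>x\<in>X. \<forall>i\<in>{1..m}. f i x \<le> 0"
    and N: "N > 0"
    and lam: "lam \<in> {0 .. 2 * sqrt (tau_star * real N)}"
    and \<mu>: "\<mu> \<in> {0 .. 2 * sqrt (tau_star * real N)}"
    and \<epsilon>: "\<epsilon> > 2 * real N powr (-1/2) * (\<mu> * M1 + M2 * R * (\<Omega> / 2 * (1 + s\<^sup>2) + lam))"
  shows "{w \<in> space M. \<exists>\<rho>. opt_value X m (\<lambda>i x. sample_average F N (\<lambda>t. \<xi> t w) i x - \<mu> * M1 * real N powr (-1/2))
             = ereal \<rho> \<and> underestimates \<epsilon> X m f \<rho>} \<in> events" (is "?T \<in> events")
    and "1 - (exp (- (real N * (s\<^sup>2 - 1))) + exp (- (lam\<^sup>2 / (4 * tau_star)))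
              + (real m + 2) * exp (- (\<mu>\<^sup>2 / (4 * tau_star))))
      \<le> prob {w \<in> space M. \<exists>\<rho>. opt_value X m (\<lambda>i x. sample_average F N (\<lambda>t. \<xi> t w) i x - \<mu> * M1 * real N powr (-1/2))
             = ereal \<rho> \<and> underestimates \<epsilon> X m f \<rho>}"
proof -
  define p where "p = real N powr (-1/2)"
  have p: "0 < p" "p * sqrt N = 1" "p * p = 1 / N"
    using N by (auto simp: p_def powr_minus powr_half_sqrt field_simps powr_add[symmetric])
  define a where "a = \<mu> * M1 * p"
  define K where "K = \<Omega> / 2 * (1 + s\<^sup>2) + lam"
  have \<Omega>_pos: "0 < \<Omega>" by (rule dual_averaging_regret(1)[OF nrm C1 strong \<omega>0 \<Omega>])
  have R_nonneg: "0 \<le> R"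
  proof -
    obtain x where "x \<in> X" using X(1) by blast
    from nrm_diff_le_covering_radius[OF nrm X(3) this this] show ?thesis
      unfolding R by (simp add: nrm_0[OF nrm])
  qed
  have K_nonneg: "0 \<le> K" using \<Omega>_pos lam by (simp add: K_def)
  have a_nonneg: "0 \<le> a" using \<mu> M p by (simp add: a_def)
  have \<epsilon>': "2 * a + 2 * R * (M2 * p * K) < \<epsilon>"
    using \<epsilon> unfolding p_def[symmetric] K_def[symmetric] a_def by (simp add: algebra_simps)
  moreover have "0 \<le> 2 * a + 2 * R * (M2 * p * K)"
    using a_nonneg R_nonneg K_nonneg p M by simp
  ultimately have \<epsilon>_pos: "0 < \<epsilon>" by linarith
  have \<xi>_meas[measurable]: "\<xi> t \<in> measurable M borel" if "t \<in> {1..N}" for t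
    using indep that by (auto simp: indep_vars_def)
  have F_meas[measurable]: "F i x \<in> borel_measurable borel" if "i \<le> m" for i x
    using borel_measurable_integrable[OF int[OF that]] by (simp add: measurable_cong_sets[OF P(2) refl])
  have f_convex: "convex_on UNIV (f i)" if "i \<le> m" for i
    unfolding f by (rule convex_on_integral[OF convex[OF that] int[OF that]])
  have convex_imp_cont: "continuous_on X g" if "convex_on UNIV g" for g :: "'e \<Rightarrow> real"
    using convex_on_continuous[OF open_UNIV that] by (rule continuous_on_subset) simp
  have f_cont: "continuous_on X (f i)" if "i \<le> m" for i
    by (intro convex_imp_cont f_convex that)
  have avg_cont: "continuous_on X (\<lambda>x. sample_average F N \<zeta> i x - a)" if "i \<le> m" for i \<zeta>
    unfolding sample_average_def by (intro continuous_intros convex_imp_cont convex that)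
  have avg_meas: "(\<lambda>w. sample_average F N (\<lambda>t. \<xi> t w) i x - a) \<in> borel_measurable M" if "i \<le> m" for i x
    unfolding sample_average_def using that
    by (intro borel_measurable_diff borel_measurable_times borel_measurable_const borel_measurable_sum)
      measurable
  show T: "?T \<in> events"
    unfolding p_def[symmetric] a_def[symmetric]
    by (rule borel_measurable_opt_value_underestimates[where f = f and m = m
          and h = "\<lambda>w i x. sample_average F N (\<lambda>t. \<xi> t w) i x - a", OF X(1,3) f_cont avg_cont avg_meas]) auto

  obtain xopt where xopt: "xopt \<in> X" "\<forall>i\<in>{1..m}. f i xopt \<le> 0"
    "\<forall>y\<in>X. (\<forall>i\<in>{1..m}. f i y \<le> 0) \<longrightarrow> f 0 xopt \<le> f 0 y"
    using opt_value_attained[where f = f and m = m and e = 0, OF X(3) f_cont feasible] by blast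
  have opt: "opt_value X m f = ereal (f 0 xopt)" by (rule opt_value_eq[OF xopt])
  have "\<exists>x\<in>X. \<forall>i\<in>{1..m}. f i x \<le> \<epsilon>" using xopt \<epsilon>_pos by (meson less_imp_le order_trans)
  then obtain xrel where xrel: "xrel \<in> X" "\<forall>i\<in>{1..m}. f i xrel \<le> \<epsilon>"
    "\<forall>y\<in>X. (\<forall>i\<in>{1..m}. f i y \<le> \<epsilon>) \<longrightarrow> f 0 xrel \<le> f 0 y"
    using opt_value_attained[where f = f and m = m and e = \<epsilon>, OF X(3) f_cont] by blast
  define r where "r = f 0 xrel - \<epsilon>"
  \<comment> \<open>The shift by \<^term>\<open>r\<close> affects the objective only.\<close>
  define \<delta> where "\<delta> i = (if i = 0 then r else 0)" for i :: nat
  have "\<exists>l. (\<forall>i\<le>m. 0 \<le> l i) \<and> (\<Sum>i\<le>m. l i) = 1 \<and> (\<forall>x\<in>X. \<epsilon> \<le> (\<Sum>i\<le>m. l i * (f i x - \<delta> i)))"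
  proof (rule convex_multipliers[OF X(1,2)])
    show "convex_on X (\<lambda>x. f i x - \<delta> i)" if "i \<le> m" for i
    proof -
      have "convex_on X (f i)" using X(2) by (intro convex_on_subset[OF f_convex[OF that]]) auto
      then show ?thesis
        using convex_on_add[of X "f i" "\<lambda>x. - \<delta> i"] X(2) by (simp add: convex_on_const)
    qed
    show "\<exists>i\<le>m. \<epsilon> \<le> f i x - \<delta> i" if x: "x \<in> X" for x
    proof (rule ccontr)
      assume neg: "\<not> (\<exists>i\<le>m. \<epsilon> \<le> f i x - \<delta> i)"
      have "\<forall>i\<in>{1..m}. f i x \<le> \<epsilon>"
      proof
        fix i assume "i \<in> {1..m}"
        then have "\<not> \<epsilon> \<le> f i x - \<delta> i" "\<delta> i = 0" using neg by (auto simp: \<delta>_def)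
        then show "f i x \<le> \<epsilon>" by simp
      qed
      then have "f 0 xrel \<le> f 0 x" using xrel(3) x by blast
      moreover have "\<not> \<epsilon> \<le> f 0 x - r" using neg by (auto simp: \<delta>_def)
      ultimately show False by (simp add: r_def)
    qed
  qed
  then obtain l where l: "\<And>i. i \<in> {..m} \<Longrightarrow> 0 \<le> l i" "(\<Sum>i\<le>m. l i) = 1"
    and l_ge: "\<And>x. x \<in> X \<Longrightarrow> \<epsilon> \<le> (\<Sum>i\<le>m. l i * (f i x - \<delta> i))" by auto

  have "continuous_on X (\<lambda>x. \<Sum>i\<le>m. l i * f i x)"
    by (intro continuous_intros f_cont) auto
  then obtain c where c: "c \<in> X" "\<And>x. x \<in> X \<Longrightarrow> (\<Sum>i\<le>m. l i * f i c) \<le> (\<Sum>i\<le>m. l i * f i x)"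
    using continuous_attains_inf[OF X(3,1)] by blast
  have "\<forall>i\<in>{..m}. \<exists>G. integrable P G \<and> (\<integral>z. G z \<partial>P) \<in> subdifferential (f i) c \<and>
      (AE z in P. subdifferential (\<lambda>y. F i y z) c = {G z})"
    using AE_unique_subgradient[OF P(1) convex int _ diff] c(1) by (auto simp: f)
  from bchoice[OF this] obtain G where G_int: "\<And>i. i \<in> {..m} \<Longrightarrow> integrable P (G i)"
    and G_mean: "\<And>i. i \<in> {..m} \<Longrightarrow> (\<integral>z. G i z \<partial>P) \<in> subdifferential (f i) c"
    and G_AE: "\<And>i. i \<in> {..m} \<Longrightarrow> AE z in P. subdifferential (\<lambda>y. F i y z) c = {G i z}"
    by blast
  define h where "h i = (\<integral>z. G i z \<partial>P)" for i
  have first_order: "0 \<le> (\<Sum>i\<le>m. l i *\<^sub>R h i) \<bullet> (y - c)" if "y \<in> X" for y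
  proof -
    have "(f i has_derivative (\<lambda>d. h i \<bullet> d)) (at c)" if i: "i \<in> {..m}" for i
    proof -
      obtain f' where f': "(f i has_derivative f') (at c)"
        using diff[of i c] i c(1) by (auto simp: differentiable_def)
      moreover have "f' = (\<lambda>d. h i \<bullet> d)"
        using subgradient_eq_derivative[OF f' G_mean[OF i]] by (auto simp: h_def)
      ultimately show ?thesis by simp
    qed
    then have "((\<lambda>x. \<Sum>i\<le>m. l i * f i x) has_derivative (\<lambda>d. \<Sum>i\<le>m. l i * (h i \<bullet> d))) (at c)"
      by (intro has_derivative_sum has_derivative_mult_right) auto
    then have "0 \<le> (\<Sum>i\<le>m. l i * (h i \<bullet> (y - c)))"
      using derivative_nonneg_at_minimum[where f = "\<lambda>x. \<Sum>i\<le>m. l i * f i x", OF _ X(2) c(1) that c(2)] by blast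
    then show ?thesis by (simp add: inner_sum_left)
  qed

  \<comment> \<open>The gradient error of one sample, and its error in the value, of the weighted combination at
    \<^term>\<open>c\<close>; the latter is oriented so that the harmful deviation is positive.\<close>
  define \<Delta> where "\<Delta> z = (\<Sum>i\<le>m. l i *\<^sub>R (G i z - h i))" for z
  define Y where "Y z = (\<Sum>i\<le>m. l i * ((f i c - F i c z) / M1))" for z
  interpret P: prob_space P by (rule P)
  have \<Delta>: "integrable P \<Delta>" "(\<integral>z. \<Delta> z \<partial>P) = 0"
    using G_int unfolding \<Delta>_def h_def by (auto simp: P.prob_space)
  have \<Delta>_bound: "AE z in P. dual_norm nrm (\<Delta> z) \<le> subgrad_deviation nrm m F f c z"
  proof -
    have "AE z in P. \<forall>i\<in>{..m}. subdifferential (\<lambda>y. F i y z) c = {G i z}"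
      using G_AE by (intro AE_finite_allI) auto
    then show ?thesis
    proof eventually_elim
      case (elim z)
      have "dual_norm nrm (\<Delta> z) \<le> (\<Sum>i\<le>m. dual_norm nrm (l i *\<^sub>R (G i z - h i)))"
        unfolding \<Delta>_def by (intro dual_norm_sum[OF nrm]) simp
      also have "\<dots> = (\<Sum>i\<le>m. l i * dual_norm nrm (G i z - h i))"
        using l(1) by (intro sum.cong dual_norm_scaleR[OF nrm]) auto
      also have "\<dots> \<le> (\<Sum>i\<le>m. l i * subgrad_deviation nrm m F f c z)"
        using l(1) elim G_mean
        by (intro sum_mono mult_left_mono subgrad_deviation_upper[OF nrm]) (auto simp: h_def)
      also have "\<dots> = subgrad_deviation nrm m F f c z"
        by (simp add: sum_distrib_right[symmetric] l(2))
      finally show ?case .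
    qed
  qed
  define D where "D z = (1 / M2) *\<^sub>R \<Delta> z" for z
  have D: "integrable P D" "(\<integral>z. D z \<partial>P) = 0" using \<Delta> unfolding D_def by auto
  have D_light: "(\<integral>\<^sup>+z. ennreal (exp ((dual_norm nrm (D z))\<^sup>2)) \<partial>P) \<le> ennreal (exp 1)"
  proof (rule order_trans[OF nn_integral_mono_AE light2[OF c(1)]])
    show "AE z in P. ennreal (exp ((dual_norm nrm (D z))\<^sup>2))
        \<le> ennreal (exp ((subgrad_deviation nrm m F f c z)\<^sup>2 / M2\<^sup>2))"
      using \<Delta>_bound
    proof eventually_elim
      case (elim z)
      have "(dual_norm nrm (D z))\<^sup>2 = (dual_norm nrm (\<Delta> z))\<^sup>2 / M2\<^sup>2"
        using M by (simp add: D_def dual_norm_scaleR[OF nrm] power_divide)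
      also have "\<dots> \<le> (subgrad_deviation nrm m F f c z)\<^sup>2 / M2\<^sup>2"
        using elim dual_norm_nonneg[OF nrm] by (intro divide_right_mono power_mono) auto
      finally show ?case by (intro ennreal_leI) simp
    qed
  qed
  have centred_light: "(\<integral>\<^sup>+z. ennreal (exp (((f i x - F i x z) / M1)\<^sup>2)) \<partial>P) \<le> ennreal (exp 1)"
    if "i \<le> m" "x \<in> X" for i x
    using light1[OF that] by (simp add: power_divide power2_commute)
  have Y_light: "(\<integral>\<^sup>+z. ennreal (exp ((Y z)\<^sup>2)) \<partial>P) \<le> ennreal (exp 1)"
  proof -
    have "(\<integral>\<^sup>+z. ennreal (exp ((Y z)\<^sup>2)) \<partial>P)
        \<le> (\<integral>\<^sup>+z. (\<Sum>i\<le>m. ennreal (l i) * ennreal (exp (((f i c - F i c z) / M1)\<^sup>2))) \<partial>P)"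
    proof (intro nn_integral_mono)
      fix z
      have "exp ((Y z)\<^sup>2) \<le> (\<Sum>i\<le>m. l i * exp (((f i c - F i c z) / M1)\<^sup>2))"
        unfolding Y_def using l by (intro exp_square_convex_combination) auto
      then have "ennreal (exp ((Y z)\<^sup>2)) \<le> ennreal (\<Sum>i\<le>m. l i * exp (((f i c - F i c z) / M1)\<^sup>2))"
        by (rule ennreal_leI)
      also have "\<dots> = (\<Sum>i\<le>m. ennreal (l i * exp (((f i c - F i c z) / M1)\<^sup>2)))"
        using l(1) by (intro sum_ennreal[symmetric]) auto
      also have "\<dots> = (\<Sum>i\<le>m. ennreal (l i) * ennreal (exp (((f i c - F i c z) / M1)\<^sup>2)))"
        using l(1) by (intro sum.cong ennreal_mult) auto
      finally show "ennreal (exp ((Y z)\<^sup>2)) \<le> (\<Sum>i\<le>m. ennreal (l i) * ennreal (exp (((f i c - F i c z) / M1)\<^sup>2)))" .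
    qed
    also have "\<dots> = (\<Sum>i\<le>m. ennreal (l i) * (\<integral>\<^sup>+z. ennreal (exp (((f i c - F i c z) / M1)\<^sup>2)) \<partial>P))"
    proof -
      have [measurable]: "F i c \<in> borel_measurable P" if "i \<le> m" for i
        using int[OF that] by (rule borel_measurable_integrable)
      show ?thesis
        by (subst nn_integral_sum, measurable) (intro sum.cong refl nn_integral_cmult, measurable)
    qed
    also have "\<dots> \<le> (\<Sum>i\<le>m. ennreal (l i) * ennreal (exp 1))"
      using centred_light c(1) by (intro sum_mono mult_left_mono) auto
    also have "\<dots> = ennreal (\<Sum>i\<le>m. l i * exp 1)"
      using l(1) by (subst sum_ennreal[symmetric]) (auto simp: ennreal_mult)
    also have "(\<Sum>i\<le>m. l i * exp 1) = exp (1::real)" by (simp add: sum_distrib_right[symmetric] l(2))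
    finally show ?thesis .
  qed
  have scalar_tail: "prob {w \<in> space M. \<mu> * sqrt N < (\<Sum>t=1..N. U (\<xi> t w))} \<le> exp (- (\<mu>\<^sup>2 / (4 * tau_star)))"
    "{w \<in> space M. \<mu> * sqrt N < (\<Sum>t=1..N. U (\<xi> t w))} \<in> events"
    if U: "integrable P U" "(\<integral>z. U z \<partial>P) = 0"
      and light: "(\<integral>\<^sup>+z. ennreal (exp ((U z)\<^sup>2)) \<partial>P) \<le> ennreal (exp 1)" for U
  proof -
    have U_meas[measurable]: "U \<in> borel_measurable borel"
      using borel_measurable_integrable[OF U(1)] by (simp add: measurable_cong_sets[OF P(2) refl])
    show "prob {w \<in> space M. \<mu> * sqrt N < (\<Sum>t=1..N. U (\<xi> t w))} \<le> exp (- (\<mu>\<^sup>2 / (4 * tau_star)))"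
      by (rule tail_predictable_mean_zero[where \<psi> = "\<lambda>s z. U z" and D = "\<lambda>z. 0 :: real",
            OF indep law P(1) _ _ U light N \<mu>]) measurable
    show "{w \<in> space M. \<mu> * sqrt N < (\<Sum>t=1..N. U (\<xi> t w))} \<in> events" by measurable
  qed

  define B where "B i = {w \<in> space M. \<mu> * sqrt N < (\<Sum>t=1..N. (F i xopt (\<xi> t w) - f i xopt) / M1)}" for i
  define B' where "B' = {w \<in> space M. \<mu> * sqrt N < (\<Sum>t=1..N. Y (\<xi> t w))}"
  define B'' where "B'' = {w \<in> space M. sqrt N * (\<Omega> / 2 * (1 + s\<^sup>2) + lam) < dual_norm nrm (\<Sum>t=1..N. D (\<xi> t w))}"
  have B: "prob (B i) \<le> exp (- (\<mu>\<^sup>2 / (4 * tau_star)))" "B i \<in> events" if i: "i \<le> m" for i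
  proof -
    have *: "integrable P (\<lambda>z. (F i xopt z - f i xopt) / M1)" "(\<integral>z. (F i xopt z - f i xopt) / M1 \<partial>P) = 0"
      using int[OF i] by (auto simp: f P.prob_space)
    have **: "(\<integral>\<^sup>+z. ennreal (exp (((F i xopt z - f i xopt) / M1)\<^sup>2)) \<partial>P) \<le> ennreal (exp 1)"
      using light1[OF i xopt(1)] by (simp add: power_divide)
    show "prob (B i) \<le> exp (- (\<mu>\<^sup>2 / (4 * tau_star)))" "B i \<in> events"
      unfolding B_def by (rule scalar_tail(1)[OF * **], rule scalar_tail(2)[OF * **])
  qed
  have Y: "integrable P Y" "(\<integral>z. Y z \<partial>P) = 0"
    using int unfolding Y_def f by (auto simp: P.prob_space)
  have B': "prob B' \<le> exp (- (\<mu>\<^sup>2 / (4 * tau_star)))" "B' \<in> events"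
    unfolding B'_def by (rule scalar_tail(1)[OF Y Y_light], rule scalar_tail(2)[OF Y Y_light])
  note tail'' = tail_dual_norm_sum[where s = s, OF nrm C1 strong \<omega>0 \<Omega> indep law P D D_light N lam]
  have B'': "prob B'' \<le> exp (- (real N * (s\<^sup>2 - 1))) + exp (- (lam\<^sup>2 / (4 * tau_star)))"
    unfolding B''_def by (rule tail''(2))
  have B''_event: "B'' \<in> events"
    unfolding B''_def by (rule tail''(1))
  define Bad where "Bad = (\<Union>i\<le>m. B i) \<union> B' \<union> B''"
  have Bad: "Bad \<in> events" using B(2) B'(2) B''_event by (auto simp: Bad_def)
  have "prob (\<Union>i\<le>m. B i) \<le> (\<Sum>i\<le>m. prob (B i))"
    using B(2) by (intro measure_UNION_le) auto
  also have "\<dots> \<le> (\<Sum>i\<le>m. exp (- (\<mu>\<^sup>2 / (4 * tau_star))))" using B(1) by (intro sum_mono) auto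
  finally have "prob (\<Union>i\<le>m. B i) \<le> (real m + 1) * exp (- (\<mu>\<^sup>2 / (4 * tau_star)))"
    by (simp add: add.commute)
  moreover have "prob Bad \<le> prob (\<Union>i\<le>m. B i) + prob B' + prob B''"
  proof -
    have UB: "(\<Union>i\<le>m. B i) \<in> events" using B(2) by auto
    have "prob Bad \<le> prob ((\<Union>i\<le>m. B i) \<union> B') + prob B''"
      unfolding Bad_def by (rule measure_Un_le[OF sets.Un[OF UB B'(2)] B''_event])
    also have "\<dots> \<le> prob (\<Union>i\<le>m. B i) + prob B' + prob B''"
      using measure_Un_le[OF UB B'(2)] by simp
    finally show ?thesis .
  qed
  ultimately have prob_Bad: "prob Bad \<le> exp (- (real N * (s\<^sup>2 - 1))) + exp (- (lam\<^sup>2 / (4 * tau_star)))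
              + (real m + 2) * exp (- (\<mu>\<^sup>2 / (4 * tau_star)))"
    using B'(1) B'' by (simp add: algebra_simps)

  have "AE w in M. subdifferential (\<lambda>y. F i y (\<xi> t w)) c = {G i (\<xi> t w)}"
    if "i \<in> {..m}" "t \<in> {1..N}" for i t
    using G_AE[OF that(1)] law[of t] that(2) by (intro AE_distrD[OF \<xi>_meas[OF that(2)]]) auto
  then have "AE w in M. \<forall>i\<in>{..m}. \<forall>t\<in>{1..N}. subdifferential (\<lambda>y. F i y (\<xi> t w)) c = {G i (\<xi> t w)}"
    by (intro AE_finite_allI) auto
  then have "AE w in M. w \<in> space M - Bad \<longrightarrow> w \<in> ?T"
  proof (eventually_elim, intro impI)
    fix w assume sub: "\<forall>i\<in>{..m}. \<forall>t\<in>{1..N}. subdifferential (\<lambda>y. F i y (\<xi> t w)) c = {G i (\<xi> t w)}"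
      and w: "w \<in> space M - Bad"
    then have w': "w \<in> space M" "w \<notin> B'" "w \<notin> B''" by (auto simp: Bad_def)
    let ?avg = "sample_average F N (\<lambda>t. \<xi> t w)"
    have sum_avg: "(\<Sum>i\<le>m. l i * ?avg i y) = p * p * (\<Sum>t=1..N. \<Sum>i\<le>m. l i * F i y (\<xi> t w))" for y
      unfolding p(3) sample_average_def
      by (subst sum.swap) (simp add: sum_distrib_left mult.left_commute)
    have upper: "?avg i xopt - a \<le> f i xopt" if i: "i \<le> m" for i
    proof -
      have "(\<Sum>t=1..N. (F i xopt (\<xi> t w) - f i xopt) / M1) \<le> \<mu> * sqrt N"
      proof -
        have "w \<notin> B i" using w i unfolding Bad_def by blast
        then show ?thesis using w by (simp add: B_def not_less)
      qed
      then have "(\<Sum>t=1..N. F i xopt (\<xi> t w)) - N * f i xopt \<le> M1 * (\<mu> * sqrt N)"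
        using M by (simp add: sum_divide_distrib[symmetric] sum_subtractf field_simps)
      then have "p * p * ((\<Sum>t=1..N. F i xopt (\<xi> t w)) - N * f i xopt) \<le> p * p * (M1 * (\<mu> * sqrt N))"
        using p by (intro mult_left_mono) auto
      also have "\<dots> = a * (p * sqrt N)" by (simp add: a_def algebra_simps)
      finally show ?thesis
        using N unfolding p sample_average_def by (simp add: algebra_simps)
    qed
    have "\<exists>x\<in>X. \<forall>i\<in>{1..m}. ?avg i x - a \<le> 0"
    proof (intro bexI[of _ xopt] ballI)
      fix i assume "i \<in> {1..m}"
      then show "?avg i xopt - a \<le> 0" using upper[of i] xopt(2) by fastforce
    qed (fact xopt(1))
    then obtain y where y: "y \<in> X" "\<forall>i\<in>{1..m}. ?avg i y - a \<le> 0"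
      "\<forall>x\<in>X. (\<forall>i\<in>{1..m}. ?avg i x - a \<le> 0) \<longrightarrow> ?avg 0 y - a \<le> ?avg 0 x - a"
      using opt_value_attained[where f = "\<lambda>i x. ?avg i x - a" and m = m and e = 0, OF X(3) avg_cont] by blast
    define \<rho> where "\<rho> = ?avg 0 y - a"
    have opt_N: "opt_value X m (\<lambda>i x. ?avg i x - a) = ereal \<rho>"
      unfolding \<rho>_def by (rule opt_value_eq[OF y])
    have "\<rho> \<le> ?avg 0 xopt - a"
      unfolding \<rho>_def
    proof (rule y(3)[rule_format, OF xopt(1)])
      fix i assume "i \<in> {1..m}"
      then show "?avg i xopt - a \<le> 0" using upper[of i] xopt(2) by fastforce
    qed
    then have le_opt: "\<rho> \<le> f 0 xopt" using upper[of 0] by simp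
    \<comment> \<open>Otherwise the sampled combination is at most the slack at \<^term>\<open>y\<close>, while its linearization at
      \<^term>\<open>c\<close> keeps it above \<^term>\<open>\<epsilon>\<close> minus the slack and the gradient error.\<close>
    have "r \<le> \<rho>"
    proof (rule ccontr)
      assume "\<not> r \<le> \<rho>"
      then have "?avg i y - \<delta> i \<le> a" if "i \<le> m" for i
        using y(2) that by (cases "i = 0") (auto simp: \<rho>_def \<delta>_def)
      then have "(\<Sum>i\<le>m. l i * (?avg i y - \<delta> i)) \<le> (\<Sum>i\<le>m. l i * a)"
        using l(1) by (intro sum_mono mult_left_mono) auto
      then have up: "(\<Sum>i\<le>m. l i * ?avg i y) - (\<Sum>i\<le>m. l i * \<delta> i) \<le> a"
        by (simp add: sum_distrib_right[symmetric] l(2) right_diff_distrib sum_subtractf)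
      have "(\<Sum>i\<le>m. l i * F i c (\<xi> t w)) + (\<Delta> (\<xi> t w) + (\<Sum>i\<le>m. l i *\<^sub>R h i)) \<bullet> (y - c)
          \<le> (\<Sum>i\<le>m. l i * F i y (\<xi> t w))" if t: "t \<in> {1..N}" for t
      proof -
        have "F i c (\<xi> t w) + G i (\<xi> t w) \<bullet> (y - c) \<le> F i y (\<xi> t w)" if "i \<in> {..m}" for i
        proof -
          have "G i (\<xi> t w) \<in> subdifferential (\<lambda>y. F i y (\<xi> t w)) c" using sub that t by simp
          then show ?thesis by (simp add: subdifferential_def)
        qed
        then have "(\<Sum>i\<le>m. l i * (F i c (\<xi> t w) + G i (\<xi> t w) \<bullet> (y - c))) \<le> (\<Sum>i\<le>m. l i * F i y (\<xi> t w))"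
          using l(1) by (intro sum_mono mult_left_mono) auto
        moreover have "(\<Delta> (\<xi> t w) + (\<Sum>i\<le>m. l i *\<^sub>R h i)) = (\<Sum>i\<le>m. l i *\<^sub>R G i (\<xi> t w))"
          unfolding \<Delta>_def sum.distrib[symmetric] by (simp add: algebra_simps)
        ultimately show ?thesis
          by (simp add: inner_sum_left distrib_left sum.distrib)
      qed
      then have "(\<Sum>t=1..N. (\<Sum>i\<le>m. l i * F i c (\<xi> t w)) + (\<Delta> (\<xi> t w) + (\<Sum>i\<le>m. l i *\<^sub>R h i)) \<bullet> (y - c))
          \<le> (\<Sum>t=1..N. \<Sum>i\<le>m. l i * F i y (\<xi> t w))" by (intro sum_mono)
      then have "(\<Sum>t=1..N. \<Sum>i\<le>m. l i * F i c (\<xi> t w)) + (\<Sum>t=1..N. \<Delta> (\<xi> t w)) \<bullet> (y - c)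
          + N * ((\<Sum>i\<le>m. l i *\<^sub>R h i) \<bullet> (y - c)) \<le> (\<Sum>t=1..N. \<Sum>i\<le>m. l i * F i y (\<xi> t w))"
        by (simp add: sum.distrib inner_add_left inner_sum_left[of "\<lambda>t. \<Delta> (\<xi> t w)"])
      moreover have "0 \<le> N * ((\<Sum>i\<le>m. l i *\<^sub>R h i) \<bullet> (y - c))"
        using first_order[OF y(1)] by simp
      ultimately have lin: "(\<Sum>t=1..N. \<Sum>i\<le>m. l i * F i c (\<xi> t w)) + (\<Sum>t=1..N. \<Delta> (\<xi> t w)) \<bullet> (y - c)
          \<le> (\<Sum>t=1..N. \<Sum>i\<le>m. l i * F i y (\<xi> t w))" by linarith
      have "- (M2 * (2 * R * (sqrt N * K))) \<le> (\<Sum>t=1..N. \<Delta> (\<xi> t w)) \<bullet> (y - c)"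
      proof -
        have eq: "(\<Sum>t=1..N. \<Delta> (\<xi> t w)) = M2 *\<^sub>R (\<Sum>t=1..N. D (\<xi> t w))"
          using M by (simp add: D_def scaleR_sum_right)
        have "(c - y) \<bullet> (\<Sum>t=1..N. D (\<xi> t w)) \<le> nrm (c - y) * dual_norm nrm (\<Sum>t=1..N. D (\<xi> t w))"
          by (rule inner_le_nrm_dual_norm[OF nrm])
        also have "\<dots> \<le> (2 * R) * (sqrt N * K)"
        proof (rule mult_mono)
          show "nrm (c - y) \<le> 2 * R"
            unfolding R by (rule nrm_diff_le_covering_radius[OF nrm X(3) c(1) y(1)])
          show "dual_norm nrm (\<Sum>t=1..N. D (\<xi> t w)) \<le> sqrt N * K"
            using w' by (simp add: B''_def K_def not_less)
        qed (use R_nonneg dual_norm_nonneg[OF nrm] in auto)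
        finally have "M2 * ((c - y) \<bullet> (\<Sum>t=1..N. D (\<xi> t w))) \<le> M2 * ((2 * R) * (sqrt N * K))"
          using M by (intro mult_left_mono) auto
        then show ?thesis
          unfolding eq by (simp add: inner_diff_left inner_diff_right inner_commute[of _ y] inner_commute[of _ c] right_diff_distrib)
      qed
      moreover have "N * (\<Sum>i\<le>m. l i * f i c) - M1 * (\<mu> * sqrt N) \<le> (\<Sum>t=1..N. \<Sum>i\<le>m. l i * F i c (\<xi> t w))"
      proof -
        have "M1 * Y z = (\<Sum>i\<le>m. l i * f i c) - (\<Sum>i\<le>m. l i * F i c z)" for z
          unfolding Y_def sum_distrib_left sum_subtractf[symmetric]
          using M by (intro sum.cong refl) (simp add: field_simps)
        then have "M1 * (\<Sum>t=1..N. Y (\<xi> t w))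
            = N * (\<Sum>i\<le>m. l i * f i c) - (\<Sum>t=1..N. \<Sum>i\<le>m. l i * F i c (\<xi> t w))"
          by (simp only: sum_distrib_left[of M1] sum_subtractf sum_constant card_atLeastAtMost) simp
        moreover have "M1 * (\<Sum>t=1..N. Y (\<xi> t w)) \<le> M1 * (\<mu> * sqrt N)"
          using w' M by (intro mult_left_mono) (simp_all add: B'_def not_less)
        ultimately show ?thesis by linarith
      qed
      ultimately have "N * (\<Sum>i\<le>m. l i * f i c) - M1 * (\<mu> * sqrt N) - M2 * (2 * R * (sqrt N * K))
          \<le> (\<Sum>t=1..N. \<Sum>i\<le>m. l i * F i y (\<xi> t w))" using lin by linarith
      then have "p * p * (N * (\<Sum>i\<le>m. l i * f i c) - M1 * (\<mu> * sqrt N) - M2 * (2 * R * (sqrt N * K)))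
          \<le> (\<Sum>i\<le>m. l i * ?avg i y)"
        unfolding sum_avg using p by (intro mult_left_mono) auto
      moreover have "p * p * (N * (\<Sum>i\<le>m. l i * f i c) - M1 * (\<mu> * sqrt N) - M2 * (2 * R * (sqrt N * K)))
          = (p * p * N) * (\<Sum>i\<le>m. l i * f i c) - (p * sqrt N) * a - (p * sqrt N) * (2 * R * (M2 * p * K))"
        by (simp add: a_def algebra_simps)
      moreover have "p * p * N = 1" using N p by simp
      ultimately have "(\<Sum>i\<le>m. l i * f i c) - a - 2 * R * (M2 * p * K) \<le> (\<Sum>i\<le>m. l i * ?avg i y)"
        using p(2) by simp
      moreover have "\<epsilon> \<le> (\<Sum>i\<le>m. l i * f i c) - (\<Sum>i\<le>m. l i * \<delta> i)"
        using l_ge[OF c(1)] by (simp add: right_diff_distrib sum_subtractf)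
      ultimately show False using up \<epsilon>' by linarith
    qed
    then have "Phi X m f \<rho> \<le> \<epsilon>"
      using xrel by (intro Phi_le[where f = f, OF X(3) f_cont]) (auto simp: r_def)
    with le_opt have "underestimates \<epsilon> X m f \<rho>" by (simp add: underestimates_def opt)
    with opt_N w show "w \<in> ?T" by (auto simp: a_def p_def)
  qed
  then have "prob (space M - Bad) \<le> prob ?T" by (intro finite_measure_mono_AE T) auto
  then show "1 - (exp (- (real N * (s\<^sup>2 - 1))) + exp (- (lam\<^sup>2 / (4 * tau_star)))
              + (real m + 2) * exp (- (\<mu>\<^sup>2 / (4 * tau_star)))) \<le> prob ?T"
    using prob_Bad prob_compl[OF Bad] by linarith
qed

text \<open>
  The complement of the support is the union of the open null sets, and in a second countable space
  countably many of them cover it.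
\<close>

lemma AE_measure_support:
  fixes P :: "'b::second_countable_topology measure"
  assumes [measurable_cong]: "sets P = sets borel"
  shows "closed (measure_support P)" and "AE z in P. z \<in> measure_support P"
proof -
  have eq: "- measure_support P = \<Union>{U. open U \<and> emeasure P U = 0}"
    by (auto simp: measure_support_def zero_less_iff_neq_zero)
  then have "open (- measure_support P)" by (simp add: open_Union)
  then show "closed (measure_support P)" by (simp add: closed_def)
  obtain \<U> where \<U>: "\<U> \<subseteq> {U. open U \<and> emeasure P U = 0}" "countable \<U>"
      "\<Union>\<U> = \<Union>{U. open U \<and> emeasure P U = 0}"
    by (rule Lindelof[of "{U. open U \<and> emeasure P U = 0}"]) auto
  have "AE z in P. z \<notin> U" if "U \<in> \<U>" for U
    using \<U>(1) that assms by (intro AE_not_in null_setsI) auto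
  then have "AE z in P. \<forall>U\<in>\<U>. z \<notin> U" using \<U>(2) by (subst AE_ball_countable) auto
  moreover have "measure_support P = - \<Union>\<U>" using eq \<U>(3) by auto
  ultimately show "AE z in P. z \<in> measure_support P" by simp
qed

theorem proposition4:
  fixes nrm :: "'a::euclidean_space \<Rightarrow> real"
    and \<omega> :: "'a \<Rightarrow> real" and grad\<omega> :: "'a \<Rightarrow> 'a"
    and X :: "'a set"
    and P :: "(real ^ 'k) measure" and \<Xi> :: "(real ^ 'k) set"
    and m :: nat
    and F :: "nat \<Rightarrow> 'a \<Rightarrow> real ^ 'k \<Rightarrow> real"
    and f :: "nat \<Rightarrow> 'a \<Rightarrow> real"
    and L :: "'a \<Rightarrow> real ^ 'k \<Rightarrow> real"
    and M :: "'w measure" and \<xi> :: "nat \<Rightarrow> 'w \<Rightarrow> real ^ 'k"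
    and N :: nat
    and M1 M2 \<Omega> R s lam \<mu> \<epsilon> \<beta> :: real
    and Opt_N :: "(nat \<Rightarrow> real ^ 'k) \<Rightarrow> ereal"
  assumes "is_norm nrm"
    and "C1_on_ball_with_gradient nrm \<omega> grad\<omega>"
    and "\<And>x y. x \<in> unit_ball nrm \<Longrightarrow> y \<in> unit_ball nrm \<Longrightarrow>
           (grad\<omega> x - grad\<omega> y) \<bullet> (x - y) \<ge> (nrm (x - y))\<^sup>2"
    and "\<omega> 0 = 0" and "grad\<omega> 0 = 0"
    and "\<Omega> = (SUP x\<in>unit_ball nrm. sqrt (2 * \<omega> x))"
    and "X \<noteq> {}" and "convex X" and "compact X"
    and "R = covering_radius nrm X"
    and "prob_space P" and "sets P = sets borel"
    and "\<Xi> = measure_support P"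
    and "\<And>i. i \<le> m \<Longrightarrow>
           (\<lambda>(x, z). F i x z) \<in> borel_measurable (restrict_space borel (UNIV \<times> \<Xi>))"
    and "\<And>i z. i \<le> m \<Longrightarrow> z \<in> \<Xi> \<Longrightarrow> convex_on UNIV (\<lambda>x. F i x z)"
    and "\<And>i x. i \<le> m \<Longrightarrow> set_integrable P \<Xi> (F i x)"
    and "f = (\<lambda>i x. LINT z:\<Xi>|P. F i x z)"
    and "L = subgrad_deviation nrm m F f"
    and "prob_space M"
    and "prob_space.indep_vars M (\<lambda>_. borel) \<xi> {1..}"
    and "\<And>t. t \<ge> 1 \<Longrightarrow> distr M borel (\<xi> t) = P"
    and "\<And>i x. i \<le> m \<Longrightarrow> x \<in> X \<Longrightarrow> f i differentiable (at x)"
    and "M1 > 0" and "M2 > 0"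
    and "\<And>i x. i \<le> m \<Longrightarrow> x \<in> X \<Longrightarrow>
           (\<integral>\<^sup>+z\<in>\<Xi>. ennreal (exp ((F i x z - f i x)\<^sup>2 / M1\<^sup>2)) \<partial>P) \<le> ennreal (exp 1)"
    and "\<And>x. x \<in> X \<Longrightarrow>
           (\<integral>\<^sup>+z\<in>\<Xi>. ennreal (exp ((L x z)\<^sup>2 / M2\<^sup>2)) \<partial>P) \<le> ennreal (exp 1)"
    and "\<exists>x\<in>X. \<forall>i\<in>{1..m}. f i x \<le> 0"
    and "N > 0" and "s > 1"
    and "lam \<in> {0 .. 2 * sqrt (tau_star * real N)}"
    and "\<mu> \<in> {0 .. 2 * sqrt (tau_star * real N)}"
    and "\<epsilon> > 2 * real N powr (-1/2) * (\<mu> * M1 + M2 * R * (\<Omega> / 2 * (1 + s\<^sup>2) + lam))"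
    and "\<beta> = exp (- (real N * (s\<^sup>2 - 1))) + exp (- (lam\<^sup>2 / (4 * tau_star)))
              + (real m + 2) * exp (- (\<mu>\<^sup>2 / (4 * tau_star)))"
    and "Opt_N = (\<lambda>z. opt_value X m (\<lambda>i x. sample_average F N z i x - \<mu> * M1 * real N powr (-1/2)))"
  shows "measure M {w \<in> space M. (\<forall>t\<in>{1..N}. \<xi> t w \<in> \<Xi>) \<and>
           (\<exists>\<rho>. Opt_N (\<lambda>t. \<xi> t w) = ereal \<rho> \<and> underestimates \<epsilon> X m f \<rho>)} \<ge> 1 - \<beta>"
proof -
  interpret M: prob_space M by fact
  note closed = AE_measure_support(1)[OF assms(12), folded assms(13)]
  note full = AE_measure_support(2)[OF assms(12), folded assms(13)]
  \<comment> \<open>Replacing the integrands by zero off the support makes them convex and integrable everywhere.\<close>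
  define F' where "F' i x z = indicator \<Xi> z * F i x z" for i x z
  have F': "F' i x z = F i x z" if "z \<in> \<Xi>" for i x z
    using that by (simp add: F'_def)
  have f: "f = (\<lambda>i x. \<integral>z. F' i x z \<partial>P)"
    unfolding assms(17) F'_def set_lebesgue_integral_def by simp
  have int: "integrable P (F' i x)" if "i \<le> m" for i x
    using assms(16)[OF that] unfolding F'_def set_integrable_def by simp
  have convex: "convex_on UNIV (\<lambda>x. F' i x z)" if "i \<le> m" for i z
  proof (cases "z \<in> \<Xi>")
    case True
    then show ?thesis using assms(15)[OF that] by (simp add: F')
  next
    case False
    then show ?thesis by (simp add: F'_def convex_on_const)
  qed
  have restrict: "(\<integral>\<^sup>+z. u z \<partial>P) = (\<integral>\<^sup>+z\<in>\<Xi>. v z \<partial>P)"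
    if "\<And>z. z \<in> \<Xi> \<Longrightarrow> u z = v z" for u v :: "real ^ 'k \<Rightarrow> ennreal"
    by (rule nn_integral_cong_AE) (use full in \<open>eventually_elim, simp add: that\<close>)
  have light1: "(\<integral>\<^sup>+z. ennreal (exp ((F' i x z - f i x)\<^sup>2 / M1\<^sup>2)) \<partial>P) \<le> ennreal (exp 1)"
    if "i \<le> m" "x \<in> X" for i x
  proof -
    have "(\<integral>\<^sup>+z. ennreal (exp ((F' i x z - f i x)\<^sup>2 / M1\<^sup>2)) \<partial>P)
        = (\<integral>\<^sup>+z\<in>\<Xi>. ennreal (exp ((F i x z - f i x)\<^sup>2 / M1\<^sup>2)) \<partial>P)"
      by (rule restrict) (simp add: F')
    then show ?thesis using assms(25)[OF that] by (simp only:)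
  qed
  have L: "subgrad_deviation nrm m F' f x z = L x z" if "z \<in> \<Xi>" for x z
    using that by (simp add: assms(18) subgrad_deviation_def F')
  have light2: "(\<integral>\<^sup>+z. ennreal (exp ((subgrad_deviation nrm m F' f x z)\<^sup>2 / M2\<^sup>2)) \<partial>P) \<le> ennreal (exp 1)"
    if "x \<in> X" for x
  proof -
    have "(\<integral>\<^sup>+z. ennreal (exp ((subgrad_deviation nrm m F' f x z)\<^sup>2 / M2\<^sup>2)) \<partial>P)
        = (\<integral>\<^sup>+z\<in>\<Xi>. ennreal (exp ((L x z)\<^sup>2 / M2\<^sup>2)) \<partial>P)"
      by (rule restrict) (simp add: L)
    then show ?thesis using assms(26)[OF that] by (simp only:)
  qed
  let ?T = "{w \<in> space M. \<exists>\<rho>. opt_value X m (\<lambda>i x. sample_average F' N (\<lambda>t. \<xi> t w) i x - \<mu> * M1 * real N powr (-1/2))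
             = ereal \<rho> \<and> underestimates \<epsilon> X m f \<rho>}"
  let ?A = "{w \<in> space M. \<forall>t\<in>{1..N}. \<xi> t w \<in> \<Xi>}"
  let ?S = "{w \<in> space M. (\<forall>t\<in>{1..N}. \<xi> t w \<in> \<Xi>) \<and>
           (\<exists>\<rho>. Opt_N (\<lambda>t. \<xi> t w) = ereal \<rho> \<and> underestimates \<epsilon> X m f \<rho>)}"
  note core = M.probability_underestimates[where F = F' and m = m and s = s,
      OF assms(1-10) assms(20,21) assms(11,12) convex int f assms(22-24) light1 light2
      assms(27,28) assms(30-32)]
  have S: "?S = ?A \<inter> ?T"
  proof -
    have "sample_average F N (\<lambda>t. \<xi> t w) = sample_average F' N (\<lambda>t. \<xi> t w)"
      if "\<forall>t\<in>{1..N}. \<xi> t w \<in> \<Xi>" for w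
      using that by (intro ext) (simp add: sample_average_def F')
    then show ?thesis unfolding assms(34) by auto
  qed
  have \<xi>: "\<xi> t \<in> measurable M borel" if "t \<in> {1..N}" for t
    using assms(20) that by (auto simp: M.indep_vars_def)
  have "AE w in M. \<xi> t w \<in> \<Xi>" if "t \<in> {1..N}" for t
    using full assms(21)[of t] that by (intro AE_distrD[OF \<xi>[OF that]]) auto
  then have A: "AE w in M. \<forall>t\<in>{1..N}. \<xi> t w \<in> \<Xi>"
    by (intro AE_finite_allI) auto
  have "{w \<in> space M. \<xi> t w \<in> \<Xi>} \<in> M.events" if "t \<in> {1..N}" for t
    using measurable_sets[OF \<xi>[OF that] borel_closed[OF closed]]
    by (simp add: vimage_def Int_def conj_commute)
  then have "?A \<in> M.events" by (intro sets.sets_Collect_finite_All) auto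
  then have "M.prob ?T \<le> M.prob ?S"
    unfolding S using core(1) A by (intro M.finite_measure_mono_AE sets.Int) auto
  then show ?thesis using core(2) unfolding assms(33) by linarith
qed

end
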